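(* Consider the linear quadratic game NZDG1, the associated optimal control problem OCP1, the problems $\mathrm{pLCP}(x_0)$ and $\mathrm{LCP}(x_0)$, and the matrix $\mathbf H$, all as defined in the context, under the assumptions stated there (feasibility; co-state affine in the state, $\lambda_k^*=H_kx_k^*+\beta_k$; invertibility of the matrices $\Gamma_{k+1}^k$, $k\in\mathcal K\setminus\{K\}$). Assume that $\mathbf H$ is positive definite. Then the solutions of $\mathrm{LCP}(x_0)$ and $\mathrm{pLCP}(x_0)$ constitute an open-loop Nash equilibrium of NZDG1; that is, if $(\mathbf v_k^*,\mu_k^* )$, $k=1,\dots,K$, solves $\mathrm{LCP}(x_0)$ and $(\mathbf v_0^*,\mu_0^* )$ solves $\mathrm{pLCP}(x_0)$, and $\mathbf u_k^*$ are the controls generated from these as in the context, then $(\tilde{\mathbf u}^*,\tilde{\mathbf v}^* )$ is an open-loop Nash equilibrium of NZDG1.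
   Context: Players $\mathcal N=\{1,\dots,N\}$, time periods $\mathcal K=\{0,1,\dots,K\}$. At time $k$ player $i$ chooses $u_k^i\in U_k^i\subset\mathbb R^{m_i}$ ($k<K$; $U_k^i$ is the set of admissible actions) and $v_k^i\in\mathbb R^{s_i}$ ($k\in\mathcal K$); $m=\sum_im_i$, $s=\sum_is_i$, $\mathbf u_k=(u_k^1,\dots,u_k^N)$, $\mathbf v_k=(v_k^1,\dots,v_k^N)$. Strategies are open-loop sequences $\tilde u^i=\{u_k^i\}_{k<K}$, $\tilde v^i=\{v_k^i\}_{k\in\mathcal K}$; $\tilde{\mathbf u}=(\tilde u^i,\tilde u^{-i})$, $\tilde{\mathbf v}=(\tilde v^i,\tilde v^{-i})$, where $-i$ denotes the players other than $i$. NZDG1: each player $i$ minimizes $$J^i=\tfrac12x_K^\prime Q_K^ix_K+{p_K^i}^\prime x_K+\sum_{k=0}^{K-1}\left(\tfrac12x_k^\prime Q_k^ix_k+{p_k^i}^\prime x_k+\tfrac12\mathbf u_k^\prime R_k^i\mathbf u_k\right)+\sum_{k=0}^K\left(\tfrac12\mathbf v_k^\prime D_k^i\mathbf v_k+{d_k^i}^\prime\mathbf v_k+x_k^\prime L_k^i\mathbf v_k\right)$$ subject to the dynamics $x_{k+1}=A_kx_k+\sum_iB_k^iu_k^i$ ($k<K$), $x_0\in\mathbb R^n$ given, and the constraints $M_kx_k+N_k\mathbf v_k+r_k\ge0$, $\mathbf v_k\ge0$ ($k\in\mathcal K$). Here $Q_k^i,D_k^i$ are symmetric and $R_k^i\in\mathbb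 R^{m\times m}$ is symmetric positive definite. A profile $(\tilde{\mathbf u}^*,\tilde{\mathbf v}^* )$ is an open-loop Nash equilibrium if for every $i\in\mathcal N$ the pair $(\tilde u^{i*},\tilde v^{i*})$ solves $\min_{(\tilde u^i,\tilde v^i)}J^i(x_0,(\tilde u^i,\tilde u^{-i*}),(\tilde v^i,\tilde v^{-i*}))$ subject to these dynamics and constraints. Potential structure: with blocks indexed by players ($[\cdot]_{ij}$ the $(i,j)$ block, $[\cdot]_{i\bullet}$ the $i$-th block row, $[\cdot]_i$ the $i$-th block of a vector), $[R_k^i]_{ij}=[R_k^j]_{ij}$ for $k<K$ and $Q_k^i=Q_k^j$, $p_k^i=p_k^j$, $L_k^i=L_k^j$, $[D_k^i]_{ij}=[D_k^j]_{ij}$ for $k\in\mathcal K$, for all $i\ne j$. OCP1 is the problem of minimizing, subject to the same dynamics and constraints, $$J=\tfrac12x_K^\prime Q_Kx_K+p_K^\prime x_K+\sum_{k=0}^{K-1}\left(\tfrac12x_k^\prime Q_kx_k+p_k^\prime x_k+\tfrac12\mathbf u_k^\prime R_k\mathbf u_k\right)+\sum_{k=0}^K\left(\tfrac12\mathbf v_k^\prime D_k\mathbf v_k+d_k^\prime\mathbf v_k+x_k^\prime L_k\mathbf v_k\right)$$ with $Q_k=Q_k^i$, $p_k=p_k^i$, $L_k=L_k^i$, $[D_k]_{i\bullet}=[D_k^i]_{i\bullet}$, $[d_k]_i=[d_k^i]_i$, $[R_k]_{i\bullet}=[R_k^i]_{i\bullet}$ for all $i$. The (symmetric) matrices $R_k$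 are invertible. Feasibility assumption: the sets $U_k^i$ are such that the sets $X_k$ of state vectors obtained from the dynamics are convex, and the sets $\{v_k^i\in\mathbb R^{s_i}: M_kx_k+N_k\mathbf v_k+r_k\ge0,\ \mathbf v_k\ge0\}$, $x_k\in X_k$, are non-empty, convex and bounded for all $k,i$. Backward equations: $\mathbf B_k=[B_k^1\ \cdots\ B_k^N]$, $S_k=\mathbf B_kR_k^{-1}\mathbf B_k^\prime$, $H_K=Q_K$, and for $k=K-1,\dots,0$, $\Gamma_{k+1}^k=\mathbf I+S_kH_{k+1}$ (assumed invertible), $H_k=Q_k+A_k^\prime H_{k+1}(\Gamma_{k+1}^k)^{-1}A_k$, $G_{k+1}=A_k^\prime-A_k^\prime H_{k+1}(\Gamma_{k+1}^k)^{-1}S_k$. Given $(\mathbf v_k^*,\mu_k^* )$, $k\in\mathcal K$: $\beta_K=p_K+L_K\mathbf v_K^*-M_K^\prime\mu_K^*$, $\beta_k=p_k+L_k\mathbf v_k^*-M_k^\prime\mu_k^*+G_{k+1}\beta_{k+1}$; $x_0^*=x_0$, $x_{k+1}^*=(\Gamma_{k+1}^k)^{-1}(A_kx_k^*-S_k\beta_{k+1})$; $\mathbf u_k^*=-R_k^{-1}\mathbf B_k^\prime(H_{k+1}x_{k+1}^*+\beta_{k+1})$; the co-states (of the necessary optimality conditions of OCP1) are assumed to be of the affine form $\lambda_k^*=H_kx_k^*+\beta_k$. Complementarity problems ($0\le a\perp b\ge0$ means $a\ge0$, $b\ge0$, $a^\prime b=0$): $\mathrm{pLCP}(x_k^* )$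 is to find $(\mathbf v_k^*,\mu_k^* )$ with $$0\le\begin{bmatrix} D_k & -N_k^\prime \\ N_k & 0 \end{bmatrix}\begin{bmatrix} \mathbf v_k^* \\ \mu_k^* \end{bmatrix}+\begin{bmatrix} L_k^\prime \\ M_k \end{bmatrix}x_k^*+\begin{bmatrix} d_k \\ r_k \end{bmatrix}\perp\begin{bmatrix} \mathbf v_k^* \\ \mu_k^* \end{bmatrix}\ge0;$$ $\mathrm{pLCP}(x_0)$ is this problem for $k=0$. Let $\bar A_k=(\Gamma_{k+1}^k)^{-1}A_k$, $\bar B_k=-(\Gamma_{k+1}^k)^{-1}S_k$, $\phi(\rho,k)=\bar A_{k-1}\cdots\bar A_\rho$ for $\rho<k$, $\phi(k,k)=\mathbf I$, $\psi(k,\tau)=G_{k+1}\cdots G_\tau$ for $\tau>k$, $\psi(k,k)=\mathbf I$. For $k,\tau\in\{1,\dots,K\}$ let $[\mathbf\Phi_0]_k=\phi(0,k)$, $[\mathbf\Phi_1]_{k\tau}=\sum_{\rho=1}^{\min(k,\tau)}\phi(\rho,k)\bar B_{\rho-1}\psi(\rho,\tau)$, $[\mathbf\Phi_2]_{k\tau}=[\mathbf\Phi_1]_{k\tau}[L_\tau\ \ -M_\tau^\prime]$. Let $\tilde{\mathbf M}=\bigoplus_{k=1}^K\begin{bmatrix} D_k & -N_k^\prime \\ N_k & 0 \end{bmatrix}$, $\tilde{\mathbf q}=\bigoplus_{k=1}^K\begin{bmatrix} L_k^\prime \\ M_k \end{bmatrix}$ (block diagonal), $\tilde{\mathbf s}=[d_1^\prime\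 r_1^\prime\cdots d_K^\prime\ r_K^\prime]^\prime$, $p_{\mathbf K}=[p_1^\prime\cdots p_K^\prime]^\prime$, $y_{\mathbf K}^*=[\mathbf v_1^{*\prime}\ \mu_1^{*\prime}\cdots\mathbf v_K^{*\prime}\ \mu_K^{*\prime}]^\prime$. $\mathrm{LCP}(x_0)$ is: find $y_{\mathbf K}^*$ with $0\le\mathbf My_{\mathbf K}^*+\mathbf q\perp y_{\mathbf K}^*\ge0$, where $\mathbf M=\tilde{\mathbf M}+\tilde{\mathbf q}\mathbf\Phi_2$, $\mathbf q=\tilde{\mathbf q}(\mathbf\Phi_0x_0+\mathbf\Phi_1p_{\mathbf K})+\tilde{\mathbf s}$. Matrix $\mathbf H$: let $E_K=Q_K$, $T_k=R_k+\mathbf B_k^\prime E_{k+1}\mathbf B_k$ (assumed invertible), $E_k=A_k^\prime E_{k+1}A_k+Q_k-A_k^\prime E_{k+1}\mathbf B_kT_k^{-1}\mathbf B_k^\prime E_{k+1}A_k$ for $k<K$ (assumed to exist). For $0\le k<\tau\le K-1$ let $\Upsilon_k^\tau=\mathbf B_\tau^\prime E_{\tau+1}A_\tau A_{\tau-1}\cdots A_{k+1}$. Then $$\mathbf H=\begin{bmatrix} \mathbf Y & \mathbf C \\ \mathbf C^\prime & \mathbf D \end{bmatrix},\qquad\mathbf D=\bigoplus_{k=0}^KD_k,$$ where $\mathbf C$ has blocks $[\mathbf C]_{lk}$ ($0\le l\le K-1$, $0\le k\le K$) equal to $\mathbf B_l^\prime A_{l+1}^\prime\cdots A_{k-1}^\prime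 L_k$ for $l<k-1$, $\mathbf B_l^\prime L_k$ for $l=k-1$, $\mathbf 0$ for $l\ge k$, and $\mathbf Y$ is the symmetric $Km\times Km$ matrix with $m\times m$ blocks ($0\le l,k\le K-1$; empty sums are zero) $$[\mathbf Y]_{kk}=T_k+\mathbf B_k^\prime\Big[\sum_{\tau=k+1}^{K-1}(\Upsilon_k^\tau)^\prime T_\tau^{-1}\Upsilon_k^\tau\Big]\mathbf B_k,$$ $$[\mathbf Y]_{kl}=\mathbf B_k^\prime E_{k+1}A_k\cdots A_{l+1}\mathbf B_l+\mathbf B_k^\prime\Big[\sum_{\tau=k+1}^{K-1}(\Upsilon_k^\tau)^\prime T_\tau^{-1}\Upsilon_k^\tau\Big]A_k\cdots A_{l+1}\mathbf B_l\quad(l<k),\qquad[\mathbf Y]_{lk}=[\mathbf Y]_{kl}^\prime.$$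
   Formalization: The formal statement additionally assumes that the generated controls u_k^{i*} lie in the admissible action sets U_k^i; without this the claim is false (e.g. U_k^i = {0} with a nonzero generated control). *)

theory Defs
  imports "HOL-Analysis.Analysis"
begin

section \<open>Player blocks\<close>

text \<open>
  The joint actions live in \<open>real^'m\<close> and \<open>real^'s\<close>.  The division into players is given by
  ownership maps \<open>own :: 'a \<Rightarrow> 'p\<close> on coordinates: block \<open>i\<close> consists of the coordinates owned by
  player \<open>i\<close>, so \<open>m_i = card (own -` {i})\<close>, with arbitrary sizes.  The space \<open>R^{m_i}\<close> is
  represented by the coordinate subspace \<open>block_space own i\<close> of the joint space.
\<close>

definition block_space :: "('a::finite \<Rightarrow> 'p) \<Rightarrow> 'p \<Rightarrow> (real^'a) set" where
  "block_space own i = {z. \<forall>a. own a \<noteq> i \<longrightarrow> z $ a = 0}"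

definition block :: "('a::finite \<Rightarrow> 'p) \<Rightarrow> 'p \<Rightarrow> real^'a \<Rightarrow> real^'a" where
  "block own i z = (\<chi> a. if own a = i then z $ a else 0)"

text \<open>The joint vector \<open>(w^i, z^{-i})\<close>.\<close>

definition replace_block :: "('a::finite \<Rightarrow> 'p) \<Rightarrow> 'p \<Rightarrow> real^'a \<Rightarrow> real^'a \<Rightarrow> real^'a" where
  "replace_block own i w z = (\<chi> a. if own a = i then w $ a else z $ a)"


section \<open>Block matrices and complementarity\<close>

text \<open>Ordered products \<open>f (b-1) ** \<dots> ** f a\<close> and \<open>f a ** \<dots> ** f (b-1)\<close>, the identity if \<open>b \<le> a\<close>.\<close>

fun prod_down :: "(nat \<Rightarrow> real^'a^'a) \<Rightarrow> nat \<Rightarrow> nat \<Rightarrow> real^'a^'a" where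
  "prod_down f a 0 = mat 1"
| "prod_down f a (Suc b) = (if a \<le> b then f b ** prod_down f a b else mat 1)"

fun prod_up :: "(nat \<Rightarrow> real^'a^'a) \<Rightarrow> nat \<Rightarrow> nat \<Rightarrow> real^'a^'a" where
  "prod_up f a 0 = mat 1"
| "prod_up f a (Suc b) = (if a \<le> b then prod_up f a b ** f b else mat 1)"

definition vstack :: "real^'a \<Rightarrow> real^'b \<Rightarrow> real^('a::finite + 'b::finite)" where
  "vstack x y = (\<chi> i. case i of Inl a \<Rightarrow> x $ a | Inr b \<Rightarrow> y $ b)"

definition rowstack :: "real^'n^'a \<Rightarrow> real^'n^'b \<Rightarrow> real^'n^('a::finite + 'b::finite)" where
  "rowstack X Y = (\<chi> i. case i of Inl a \<Rightarrow> X $ a | Inr b \<Rightarrow> Y $ b)"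

definition colstack :: "real^'a^'n \<Rightarrow> real^'b^'n \<Rightarrow> real^('a::finite + 'b::finite)^'n" where
  "colstack X Y = (\<chi> i. vstack (X $ i) (Y $ i))"

text \<open>
  Matrices with blocks indexed by time are functions of the two block indices; products sum over
  the set \<open>I\<close> of time indices in question.
\<close>

definition bdiag :: "(nat \<Rightarrow> real^'b^'a) \<Rightarrow> nat \<Rightarrow> nat \<Rightarrow> real^'b^'a" where
  "bdiag f k l = (if k = l then f k else 0)"

definition bmm :: "nat set \<Rightarrow> (nat \<Rightarrow> nat \<Rightarrow> real^'b^'a) \<Rightarrow> (nat \<Rightarrow> nat \<Rightarrow> real^'c^'b)
    \<Rightarrow> nat \<Rightarrow> nat \<Rightarrow> real^'c^'a" where
  "bmm I X Y k l = (\<Sum>j\<in>I. X k j ** Y j l)"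

definition bmv :: "nat set \<Rightarrow> (nat \<Rightarrow> nat \<Rightarrow> real^'b^'a) \<Rightarrow> (nat \<Rightarrow> real^'b) \<Rightarrow> nat \<Rightarrow> real^'a" where
  "bmv I X y k = (\<Sum>j\<in>I. X k j *v y j)"

definition complementary :: "real^'a \<Rightarrow> real^'a \<Rightarrow> bool" where
  "complementary a b \<longleftrightarrow> 0 \<le> a \<and> 0 \<le> b \<and> a \<bullet> b = 0"

text \<open>The same for vectors with blocks indexed by the finite set \<open>I\<close>.\<close>

definition bcomplementary :: "nat set \<Rightarrow> (nat \<Rightarrow> real^'a) \<Rightarrow> (nat \<Rightarrow> real^'a) \<Rightarrow> bool" where
  "bcomplementary I a b \<longleftrightarrow>
     (\<forall>k\<in>I. 0 \<le> a k) \<and> (\<forall>k\<in>I. 0 \<le> b k) \<and> (\<Sum>k\<in>I. a k \<bullet> b k) = 0"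

text \<open>Positive definiteness of a real matrix with entries \<open>X i j\<close>, \<open>i, j \<in> I\<close>, for a finite set \<open>I\<close>.\<close>

definition pos_def_on :: "'i set \<Rightarrow> ('i \<Rightarrow> 'i \<Rightarrow> real) \<Rightarrow> bool" where
  "pos_def_on I X \<longleftrightarrow>
     (\<forall>z. (\<exists>i\<in>I. z i \<noteq> 0) \<longrightarrow> 0 < (\<Sum>i\<in>I. \<Sum>j\<in>I. z i * X i j * z j))"


section \<open>The game NZDG1\<close>

text \<open>
  Type parameters: \<open>'n\<close> states, \<open>'m\<close> and \<open>'s\<close> coordinates of the joint actions \<open>u_k\<close> and \<open>v_k\<close>,
  \<open>'c\<close> constraint rows, \<open>'p\<close> players.  The first argument of every field is the time \<open>k\<close>, the
  player index comes second.  Only the columns of \<open>B_k^i\<close> belonging to block \<open>i\<close> are ever used.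
\<close>

record ('n::finite, 'm::finite, 's::finite, 'c::finite, 'p::finite) nzdg1 =
  horizon :: nat
  own_u :: "'m \<Rightarrow> 'p"
  own_v :: "'s \<Rightarrow> 'p"
  actions :: "nat \<Rightarrow> 'p \<Rightarrow> (real^'m) set"
  x_init :: "real^'n"
  Amat :: "nat \<Rightarrow> real^'n^'n"
  Bmat :: "nat \<Rightarrow> 'p \<Rightarrow> real^'m^'n"
  Qmat :: "nat \<Rightarrow> 'p \<Rightarrow> real^'n^'n"
  pvec :: "nat \<Rightarrow> 'p \<Rightarrow> real^'n"
  Rmat :: "nat \<Rightarrow> 'p \<Rightarrow> real^'m^'m"
  Dmat :: "nat \<Rightarrow> 'p \<Rightarrow> real^'s^'s"
  dvec :: "nat \<Rightarrow> 'p \<Rightarrow> real^'s"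
  Lmat :: "nat \<Rightarrow> 'p \<Rightarrow> real^'s^'n"
  Mmat :: "nat \<Rightarrow> real^'n^'c"
  Nmat :: "nat \<Rightarrow> real^'s^'c"
  rvec :: "nat \<Rightarrow> real^'c"

definition game_data :: "('n::finite,'m::finite,'s::finite,'c::finite,'p::finite) nzdg1 \<Rightarrow> bool" where
  "game_data g \<longleftrightarrow>
     (\<forall>k<horizon g. \<forall>i. actions g k i \<subseteq> block_space (own_u g) i) \<and>
     (\<forall>k\<le>horizon g. \<forall>i. transpose (Qmat g k i) = Qmat g k i) \<and>
     (\<forall>k\<le>horizon g. \<forall>i. transpose (Dmat g k i) = Dmat g k i) \<and>
     (\<forall>k<horizon g. \<forall>i. transpose (Rmat g k i) = Rmat g k i \<and>
        pos_def_on UNIV (\<lambda>a b. Rmat g k i $ a $ b))"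

definition step ::
  "('n::finite,'m::finite,'s::finite,'c::finite,'p::finite) nzdg1 \<Rightarrow> nat \<Rightarrow> real^'n \<Rightarrow> real^'m \<Rightarrow> real^'n" where
  "step g k x u = Amat g k *v x + (\<Sum>i\<in>UNIV. Bmat g k i *v block (own_u g) i u)"

fun trajectory ::
  "('n::finite,'m::finite,'s::finite,'c::finite,'p::finite) nzdg1 \<Rightarrow> (nat \<Rightarrow> real^'m) \<Rightarrow> nat \<Rightarrow> real^'n" where
  "trajectory g u 0 = x_init g"
| "trajectory g u (Suc k) = step g k (trajectory g u k) (u k)"

definition constraints ::
  "('n::finite,'m::finite,'s::finite,'c::finite,'p::finite) nzdg1 \<Rightarrow> nat \<Rightarrow> real^'n \<Rightarrow> real^'s \<Rightarrow> bool" where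
  "constraints g k x v \<longleftrightarrow> 0 \<le> Mmat g k *v x + Nmat g k *v v + rvec g k \<and> 0 \<le> v"

definition cost ::
  "('n::finite,'m::finite,'s::finite,'c::finite,'p::finite) nzdg1 \<Rightarrow> 'p
    \<Rightarrow> (nat \<Rightarrow> real^'m) \<Rightarrow> (nat \<Rightarrow> real^'s) \<Rightarrow> real" where
  "cost g i u v = (let K = horizon g; x = trajectory g u in
     1/2 * (x K \<bullet> (Qmat g K i *v x K)) + pvec g K i \<bullet> x K
     + (\<Sum>k<K. 1/2 * (x k \<bullet> (Qmat g k i *v x k)) + pvec g k i \<bullet> x k
               + 1/2 * (u k \<bullet> (Rmat g k i *v u k)))
     + (\<Sum>k\<le>K. 1/2 * (v k \<bullet> (Dmat g k i *v v k)) + dvec g k i \<bullet> v k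
               + x k \<bullet> (Lmat g k i *v v k)))"

definition admissible ::
  "('n::finite,'m::finite,'s::finite,'c::finite,'p::finite) nzdg1 \<Rightarrow> 'p \<Rightarrow> (nat \<Rightarrow> real^'m) \<Rightarrow> bool" where
  "admissible g i u \<longleftrightarrow> (\<forall>k<horizon g. block (own_u g) i (u k) \<in> actions g k i)"

definition deviation ::
  "('a::finite \<Rightarrow> 'p) \<Rightarrow> 'p \<Rightarrow> (nat \<Rightarrow> real^'a) \<Rightarrow> (nat \<Rightarrow> real^'a) \<Rightarrow> nat \<Rightarrow> real^'a" where
  "deviation own i w z k = replace_block own i (w k) (z k)"

text \<open>
  In the minimisation problem of player \<open>i\<close> the strategies of player \<open>i\<close> are the \<open>i\<close>-blocks of
  \<open>(u', v')\<close>; the other blocks of \<open>u'\<close>, \<open>v'\<close> are overwritten by the equilibrium strategies.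
\<close>

definition open_loop_nash ::
  "('n::finite,'m::finite,'s::finite,'c::finite,'p::finite) nzdg1
    \<Rightarrow> (nat \<Rightarrow> real^'m) \<Rightarrow> (nat \<Rightarrow> real^'s) \<Rightarrow> bool" where
  "open_loop_nash g u v \<longleftrightarrow>
     (\<forall>i. is_arg_min
        (\<lambda>(u', v'). cost g i (deviation (own_u g) i u' u) (deviation (own_v g) i v' v))
        (\<lambda>(u', v'). admissible g i u' \<and>
           (\<forall>k\<le>horizon g. constraints g k
              (trajectory g (deviation (own_u g) i u' u) k) (deviation (own_v g) i v' v k)))
        (u, v))"


section \<open>Feasibility\<close>

fun reachable ::
  "('n::finite,'m::finite,'s::finite,'c::finite,'p::finite) nzdg1 \<Rightarrow> nat \<Rightarrow> (real^'n) set" where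
  "reachable g 0 = {x_init g}"
| "reachable g (Suc k) =
     {step g k x u | x u. x \<in> reachable g k \<and> (\<forall>i. block (own_u g) i u \<in> actions g k i)}"

text \<open>The set of \<open>v_k^i\<close> that satisfy the constraints when the other players use \<open>w^{-i}\<close>.\<close>

definition v_section ::
  "('n::finite,'m::finite,'s::finite,'c::finite,'p::finite) nzdg1
    \<Rightarrow> nat \<Rightarrow> 'p \<Rightarrow> real^'n \<Rightarrow> real^'s \<Rightarrow> (real^'s) set" where
  "v_section g k i x w =
     {z \<in> block_space (own_v g) i. constraints g k x (replace_block (own_v g) i z w)}"

text \<open>
  Non-emptiness cannot be required for every \<open>w^{-i}\<close> (it fails, e.g., if \<open>w^{-i}\<close> has a negative
  entry); it is required for some \<open>w^{-i}\<close>.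
\<close>

definition feasibility :: "('n::finite,'m::finite,'s::finite,'c::finite,'p::finite) nzdg1 \<Rightarrow> bool" where
  "feasibility g \<longleftrightarrow>
     (\<forall>k\<le>horizon g. convex (reachable g k)) \<and>
     (\<forall>k\<le>horizon g. \<forall>i. \<forall>x\<in>reachable g k.
        (\<exists>w. v_section g k i x w \<noteq> {}) \<and>
        (\<forall>w. convex (v_section g k i x w) \<and> bounded (v_section g k i x w)))"


section \<open>Potential structure and the data of OCP1\<close>

definition potential_structure ::
  "('n::finite,'m::finite,'s::finite,'c::finite,'p::finite) nzdg1 \<Rightarrow> bool" where
  "potential_structure g \<longleftrightarrow>
     (\<forall>i j. i \<noteq> j \<longrightarrow>
       (\<forall>k<horizon g. \<forall>a b. own_u g a = i \<and> own_u g b = j \<longrightarrow>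
          Rmat g k i $ a $ b = Rmat g k j $ a $ b) \<and>
       (\<forall>k\<le>horizon g.
          Qmat g k i = Qmat g k j \<and> pvec g k i = pvec g k j \<and> Lmat g k i = Lmat g k j \<and>
          (\<forall>a b. own_v g a = i \<and> own_v g b = j \<longrightarrow>
             Dmat g k i $ a $ b = Dmat g k j $ a $ b)))"

text \<open>
  \<open>Q_k\<close>, \<open>p_k\<close>, \<open>L_k\<close> are the values common to all players; row \<open>a\<close> of \<open>D_k\<close>, \<open>d_k\<close>, \<open>R_k\<close> is taken
  from the player who owns \<open>a\<close>.
\<close>

definition ocpQ :: "('n::finite,'m::finite,'s::finite,'c::finite,'p::finite) nzdg1 \<Rightarrow> nat \<Rightarrow> real^'n^'n" where
  "ocpQ g k = (THE X. \<forall>i. Qmat g k i = X)"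

definition ocpp :: "('n::finite,'m::finite,'s::finite,'c::finite,'p::finite) nzdg1 \<Rightarrow> nat \<Rightarrow> real^'n" where
  "ocpp g k = (THE y. \<forall>i. pvec g k i = y)"

definition ocpL :: "('n::finite,'m::finite,'s::finite,'c::finite,'p::finite) nzdg1 \<Rightarrow> nat \<Rightarrow> real^'s^'n" where
  "ocpL g k = (THE X. \<forall>i. Lmat g k i = X)"

definition ocpD :: "('n::finite,'m::finite,'s::finite,'c::finite,'p::finite) nzdg1 \<Rightarrow> nat \<Rightarrow> real^'s^'s" where
  "ocpD g k = (\<chi> a b. Dmat g k (own_v g a) $ a $ b)"

definition ocpd :: "('n::finite,'m::finite,'s::finite,'c::finite,'p::finite) nzdg1 \<Rightarrow> nat \<Rightarrow> real^'s" where
  "ocpd g k = (\<chi> a. dvec g k (own_v g a) $ a)"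

definition ocpR :: "('n::finite,'m::finite,'s::finite,'c::finite,'p::finite) nzdg1 \<Rightarrow> nat \<Rightarrow> real^'m^'m" where
  "ocpR g k = (\<chi> a b. Rmat g k (own_u g a) $ a $ b)"

text \<open>\<open>\<^bold>B_k = [B_k^1 \<dots> B_k^N]\<close>\<close>

definition ocpB :: "('n::finite,'m::finite,'s::finite,'c::finite,'p::finite) nzdg1 \<Rightarrow> nat \<Rightarrow> real^'m^'n" where
  "ocpB g k = (\<chi> r a. Bmat g k (own_u g a) $ r $ a)"


section \<open>Backward equations and generated controls\<close>

definition Smat :: "('n::finite,'m::finite,'s::finite,'c::finite,'p::finite) nzdg1 \<Rightarrow> nat \<Rightarrow> real^'n^'n" where
  "Smat g k = ocpB g k ** matrix_inv (ocpR g k) ** transpose (ocpB g k)"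

function Hric :: "('n::finite,'m::finite,'s::finite,'c::finite,'p::finite) nzdg1 \<Rightarrow> nat \<Rightarrow> real^'n^'n" where
  "Hric g k = (if k < horizon g
     then ocpQ g k + transpose (Amat g k) ** Hric g (Suc k)
            ** matrix_inv (mat 1 + Smat g k ** Hric g (Suc k)) ** Amat g k
     else ocpQ g (horizon g))"
  by pat_completeness auto
termination by (relation "Wellfounded.measure (\<lambda>(g, k). horizon g - k)") auto

declare Hric.simps [simp del]

text \<open>\<open>Gam g k\<close> is \<open>\<Gamma>_{k+1}^k\<close>, while \<open>Gmat g k\<close> is \<open>G_k\<close> (for \<open>k \<ge> 1\<close>).\<close>

definition Gam :: "('n::finite,'m::finite,'s::finite,'c::finite,'p::finite) nzdg1 \<Rightarrow> nat \<Rightarrow> real^'n^'n" where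
  "Gam g k = mat 1 + Smat g k ** Hric g (Suc k)"

definition Gmat :: "('n::finite,'m::finite,'s::finite,'c::finite,'p::finite) nzdg1 \<Rightarrow> nat \<Rightarrow> real^'n^'n" where
  "Gmat g k = transpose (Amat g (k - 1))
     - transpose (Amat g (k - 1)) ** Hric g k ** matrix_inv (Gam g (k - 1)) ** Smat g (k - 1)"

function beta ::
  "('n::finite,'m::finite,'s::finite,'c::finite,'p::finite) nzdg1
    \<Rightarrow> (nat \<Rightarrow> real^'s) \<Rightarrow> (nat \<Rightarrow> real^'c) \<Rightarrow> nat \<Rightarrow> real^'n" where
  "beta g v \<mu> k =
     ocpp g k + ocpL g k *v v k - transpose (Mmat g k) *v \<mu> k
     + (if k < horizon g then Gmat g (Suc k) *v beta g v \<mu> (Suc k) else 0)"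
  by pat_completeness auto
termination by (relation "Wellfounded.measure (\<lambda>(g, v, \<mu>, k). horizon g - k)") auto

declare beta.simps [simp del]

fun xstar ::
  "('n::finite,'m::finite,'s::finite,'c::finite,'p::finite) nzdg1
    \<Rightarrow> (nat \<Rightarrow> real^'s) \<Rightarrow> (nat \<Rightarrow> real^'c) \<Rightarrow> nat \<Rightarrow> real^'n" where
  "xstar g v \<mu> 0 = x_init g"
| "xstar g v \<mu> (Suc k) =
     matrix_inv (Gam g k) *v (Amat g k *v xstar g v \<mu> k - Smat g k *v beta g v \<mu> (Suc k))"

definition ustar ::
  "('n::finite,'m::finite,'s::finite,'c::finite,'p::finite) nzdg1
    \<Rightarrow> (nat \<Rightarrow> real^'s) \<Rightarrow> (nat \<Rightarrow> real^'c) \<Rightarrow> nat \<Rightarrow> real^'m" where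
  "ustar g v \<mu> k = - (matrix_inv (ocpR g k) *v (transpose (ocpB g k) *v
     (Hric g (Suc k) *v xstar g v \<mu> (Suc k) + beta g v \<mu> (Suc k))))"

text \<open>
  The co-state equations among the necessary optimality conditions of OCP1: \<open>\<lambda>_k\<close> is the gradient
  in \<open>x_k\<close> of the stage cost minus \<open>\<mu>_k'(M_k x_k + N_k v_k + r_k)\<close> plus \<open>\<lambda>_{k+1}'(A_k x_k + \<dots>)\<close>.
\<close>

definition costates ::
  "('n::finite,'m::finite,'s::finite,'c::finite,'p::finite) nzdg1
    \<Rightarrow> (nat \<Rightarrow> real^'n) \<Rightarrow> (nat \<Rightarrow> real^'s) \<Rightarrow> (nat \<Rightarrow> real^'c) \<Rightarrow> (nat \<Rightarrow> real^'n) \<Rightarrow> bool" where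
  "costates g x v \<mu> l \<longleftrightarrow> (let K = horizon g in
     l K = ocpQ g K *v x K + ocpp g K + ocpL g K *v v K - transpose (Mmat g K) *v \<mu> K \<and>
     (\<forall>k<K. l k = ocpQ g k *v x k + ocpp g k + ocpL g k *v v k - transpose (Mmat g k) *v \<mu> k
                  + transpose (Amat g k) *v l (Suc k)))"

definition affine_costates ::
  "('n::finite,'m::finite,'s::finite,'c::finite,'p::finite) nzdg1
    \<Rightarrow> (nat \<Rightarrow> real^'s) \<Rightarrow> (nat \<Rightarrow> real^'c) \<Rightarrow> bool" where
  "affine_costates g v \<mu> \<longleftrightarrow>
     (\<forall>l. costates g (xstar g v \<mu>) v \<mu> l \<longrightarrow>
       (\<forall>k\<le>horizon g. l k = Hric g k *v xstar g v \<mu> k + beta g v \<mu> k))"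


section \<open>The complementarity problems\<close>

definition lcpM ::
  "('n::finite,'m::finite,'s::finite,'c::finite,'p::finite) nzdg1 \<Rightarrow> nat \<Rightarrow> real^('s + 'c)^('s + 'c)" where
  "lcpM g k = rowstack (colstack (ocpD g k) (- transpose (Nmat g k))) (colstack (Nmat g k) 0)"

definition lcpq ::
  "('n::finite,'m::finite,'s::finite,'c::finite,'p::finite) nzdg1 \<Rightarrow> nat \<Rightarrow> real^'n^('s + 'c)" where
  "lcpq g k = rowstack (transpose (ocpL g k)) (Mmat g k)"

definition lcps ::
  "('n::finite,'m::finite,'s::finite,'c::finite,'p::finite) nzdg1 \<Rightarrow> nat \<Rightarrow> real^('s + 'c)" where
  "lcps g k = vstack (ocpd g k) (rvec g k)"

definition pLCP ::
  "('n::finite,'m::finite,'s::finite,'c::finite,'p::finite) nzdg1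
    \<Rightarrow> nat \<Rightarrow> real^'n \<Rightarrow> real^'s \<Rightarrow> real^'c \<Rightarrow> bool" where
  "pLCP g k x v \<mu> \<longleftrightarrow>
     complementary (lcpM g k *v vstack v \<mu> + lcpq g k *v x + lcps g k) (vstack v \<mu>)"

definition Abar :: "('n::finite,'m::finite,'s::finite,'c::finite,'p::finite) nzdg1 \<Rightarrow> nat \<Rightarrow> real^'n^'n" where
  "Abar g k = matrix_inv (Gam g k) ** Amat g k"

definition Bbar :: "('n::finite,'m::finite,'s::finite,'c::finite,'p::finite) nzdg1 \<Rightarrow> nat \<Rightarrow> real^'n^'n" where
  "Bbar g k = - (matrix_inv (Gam g k) ** Smat g k)"

definition phi :: "('n::finite,'m::finite,'s::finite,'c::finite,'p::finite) nzdg1 \<Rightarrow> nat \<Rightarrow> nat \<Rightarrow> real^'n^'n" where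
  "phi g \<rho> k = prod_down (Abar g) \<rho> k"

definition psi :: "('n::finite,'m::finite,'s::finite,'c::finite,'p::finite) nzdg1 \<Rightarrow> nat \<Rightarrow> nat \<Rightarrow> real^'n^'n" where
  "psi g k \<tau> = prod_up (Gmat g) (Suc k) (Suc \<tau>)"

definition Phi0 :: "('n::finite,'m::finite,'s::finite,'c::finite,'p::finite) nzdg1 \<Rightarrow> nat \<Rightarrow> real^'n^'n" where
  "Phi0 g k = phi g 0 k"

definition Phi1 :: "('n::finite,'m::finite,'s::finite,'c::finite,'p::finite) nzdg1 \<Rightarrow> nat \<Rightarrow> nat \<Rightarrow> real^'n^'n" where
  "Phi1 g k \<tau> = (\<Sum>\<rho>=1..min k \<tau>. phi g \<rho> k ** Bbar g (\<rho> - 1) ** psi g \<rho> \<tau>)"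

definition Phi2 ::
  "('n::finite,'m::finite,'s::finite,'c::finite,'p::finite) nzdg1 \<Rightarrow> nat \<Rightarrow> nat \<Rightarrow> real^('s + 'c)^'n" where
  "Phi2 g k \<tau> = Phi1 g k \<tau> ** colstack (ocpL g \<tau>) (- transpose (Mmat g \<tau>))"

definition bigM ::
  "('n::finite,'m::finite,'s::finite,'c::finite,'p::finite) nzdg1
    \<Rightarrow> nat \<Rightarrow> nat \<Rightarrow> real^('s + 'c)^('s + 'c)" where
  "bigM g k \<tau> = bdiag (lcpM g) k \<tau> + bmm {1..horizon g} (bdiag (lcpq g)) (Phi2 g) k \<tau>"

definition bigq ::
  "('n::finite,'m::finite,'s::finite,'c::finite,'p::finite) nzdg1 \<Rightarrow> nat \<Rightarrow> real^('s + 'c)" where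
  "bigq g k =
     bmv {1..horizon g} (bdiag (lcpq g))
       (\<lambda>j. Phi0 g j *v x_init g + bmv {1..horizon g} (Phi1 g) (ocpp g) j) k
     + lcps g k"

definition LCP ::
  "('n::finite,'m::finite,'s::finite,'c::finite,'p::finite) nzdg1
    \<Rightarrow> (nat \<Rightarrow> real^'s) \<Rightarrow> (nat \<Rightarrow> real^'c) \<Rightarrow> bool" where
  "LCP g v \<mu> \<longleftrightarrow> (let y = (\<lambda>k. vstack (v k) (\<mu> k)) in
     bcomplementary {1..horizon g} (\<lambda>k. bmv {1..horizon g} (bigM g) y k + bigq g k) y)"


section \<open>The matrix H\<close>

function Emat :: "('n::finite,'m::finite,'s::finite,'c::finite,'p::finite) nzdg1 \<Rightarrow> nat \<Rightarrow> real^'n^'n" where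
  "Emat g k = (if k < horizon g
     then transpose (Amat g k) ** Emat g (Suc k) ** Amat g k + ocpQ g k
          - transpose (Amat g k) ** Emat g (Suc k) ** ocpB g k
            ** matrix_inv (ocpR g k + transpose (ocpB g k) ** Emat g (Suc k) ** ocpB g k)
            ** transpose (ocpB g k) ** Emat g (Suc k) ** Amat g k
     else ocpQ g (horizon g))"
  by pat_completeness auto
termination by (relation "Wellfounded.measure (\<lambda>(g, k). horizon g - k)") auto

declare Emat.simps [simp del]

definition Tmat :: "('n::finite,'m::finite,'s::finite,'c::finite,'p::finite) nzdg1 \<Rightarrow> nat \<Rightarrow> real^'m^'m" where
  "Tmat g k = ocpR g k + transpose (ocpB g k) ** Emat g (Suc k) ** ocpB g k"

definition Ups ::
  "('n::finite,'m::finite,'s::finite,'c::finite,'p::finite) nzdg1 \<Rightarrow> nat \<Rightarrow> nat \<Rightarrow> real^'n^'m" where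
  "Ups g k \<tau> = transpose (ocpB g \<tau>) ** Emat g (Suc \<tau>) ** prod_down (Amat g) (Suc k) (Suc \<tau>)"

definition UpsSum :: "('n::finite,'m::finite,'s::finite,'c::finite,'p::finite) nzdg1 \<Rightarrow> nat \<Rightarrow> real^'n^'n" where
  "UpsSum g k = (\<Sum>\<tau>\<in>{Suc k..<horizon g}.
     transpose (Ups g k \<tau>) ** matrix_inv (Tmat g \<tau>) ** Ups g k \<tau>)"

text \<open>The block \<open>[Y]_{kl}\<close> for \<open>l < k\<close>.\<close>

definition Ylow ::
  "('n::finite,'m::finite,'s::finite,'c::finite,'p::finite) nzdg1 \<Rightarrow> nat \<Rightarrow> nat \<Rightarrow> real^'m^'m" where
  "Ylow g k l =
     transpose (ocpB g k) ** Emat g (Suc k) ** prod_down (Amat g) (Suc l) (Suc k) ** ocpB g l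
     + transpose (ocpB g k) ** UpsSum g k ** prod_down (Amat g) (Suc l) (Suc k) ** ocpB g l"

definition Ymat ::
  "('n::finite,'m::finite,'s::finite,'c::finite,'p::finite) nzdg1 \<Rightarrow> nat \<Rightarrow> nat \<Rightarrow> real^'m^'m" where
  "Ymat g k l =
     (if k = l then Tmat g k + transpose (ocpB g k) ** UpsSum g k ** ocpB g k
      else if l < k then Ylow g k l
      else transpose (Ylow g l k))"

definition Cmat ::
  "('n::finite,'m::finite,'s::finite,'c::finite,'p::finite) nzdg1 \<Rightarrow> nat \<Rightarrow> nat \<Rightarrow> real^'s^'m" where
  "Cmat g l k =
     (if Suc l < k then transpose (ocpB g l)
          ** prod_up (\<lambda>j. transpose (Amat g j)) (Suc l) k ** ocpL g k
      else if Suc l = k then transpose (ocpB g l) ** ocpL g k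
      else 0)"

text \<open>
  Rows and columns of the matrix \<open>[Y, C; C', D]\<close> are indexed by \<open>Inl (k, a)\<close> with \<open>k < K\<close> for the
  entries of \<open>u_k\<close> and by \<open>Inr (k, b)\<close> with \<open>k \<le> K\<close> for those of \<open>v_k\<close>.
\<close>

definition bigH_index ::
  "('n::finite,'m::finite,'s::finite,'c::finite,'p::finite) nzdg1 \<Rightarrow> (nat \<times> 'm + nat \<times> 's) set" where
  "bigH_index g = ({..<horizon g} \<times> UNIV) <+> ({..horizon g} \<times> UNIV)"

fun bigH ::
  "('n::finite,'m::finite,'s::finite,'c::finite,'p::finite) nzdg1
    \<Rightarrow> (nat \<times> 'm + nat \<times> 's) \<Rightarrow> (nat \<times> 'm + nat \<times> 's) \<Rightarrow> real" where
  "bigH g (Inl (k, a)) (Inl (l, b)) = Ymat g k l $ a $ b"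
| "bigH g (Inl (k, a)) (Inr (l, b)) = Cmat g k l $ a $ b"
| "bigH g (Inr (k, a)) (Inl (l, b)) = transpose (Cmat g l k) $ a $ b"
| "bigH g (Inr (k, a)) (Inr (l, b)) = bdiag (ocpD g) k l $ a $ b"

end

theory Submission
  imports Defs
begin

text \<open>
  If player \<open>i\<close> deviates by \<open>(w, s)\<close> and \<open>y\<close> is the resulting change of the state, the cost of
  player \<open>i\<close> changes by a part linear in \<open>(y, w, s)\<close> plus a quadratic form.  As \<open>w\<close> and \<open>s\<close> vanish
  outside block \<open>i\<close>, the potential structure lets one replace the data of player \<open>i\<close> by those of OCP1
  in both parts.  By the co-state equations and \<open>R_k u_k = - B_k' \<lambda>_{k+1}\<close> the linear part telescopes to
  a sum over \<open>k\<close> of terms that are non-negative since \<open>(v_k, \<mu>_k)\<close> solves \<open>pLCP(x_k)\<close>.  The quadratic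
  form is that of \<open>\<^bold>H\<close>: the Riccati recursion for \<open>E_k\<close> completes the squares and shows that \<open>\<^bold>Y\<close>
  is the quadratic form of the state and control costs as a function of the controls.
\<close>

text \<open>As a simp rule this turns \<open>transpose A *v x\<close> into \<open>x v* A\<close>,
  out of the form needed by the adjoint identity \<open>inner_transpose_mult\<close>.\<close>

declare transpose_matrix_vector [simp del]

section \<open>Matrices and vectors\<close>

lemma inner_transpose_mult:
  fixes A :: "real^'n^'m"
  shows "x \<bullet> (transpose A *v y) = (A *v x) \<bullet> y"
  by (metis dot_lmul_matrix inner_commute transpose_matrix_vector)

lemma matrix_inv_mult:
  fixes A :: "real^'n^'n"
  assumes "invertible A"
  shows "A ** matrix_inv A = mat 1" and "matrix_inv A ** A = mat 1"
proof -
  have "\<exists>B. A ** B = mat 1 \<and> B ** A = mat 1"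
    using assms by (simp add: invertible_def)
  from someI_ex[OF this] show "A ** matrix_inv A = mat 1" "matrix_inv A ** A = mat 1"
    by (simp_all add: matrix_inv_def)
qed

text \<open>Transposing \<open>A ** matrix_inv A = mat 1\<close> makes the transposed inverse a left
  inverse of the symmetric \<open>A\<close>, and left inverses are unique.\<close>

lemma transpose_matrix_inv:
  fixes A :: "real^'n^'n"
  assumes "invertible A" and "transpose A = A"
  shows "transpose (matrix_inv A) = matrix_inv A"
proof -
  have "transpose (matrix_inv A) ** A = mat 1"
    by (metis assms matrix_inv_mult(1) matrix_transpose_mul transpose_mat)
  then show ?thesis
    by (metis assms(1) matrix_inv_mult(1) matrix_mul_assoc matrix_mul_lid matrix_mul_rid)
qed

lemma transpose_add: "transpose (A + B) = transpose A + transpose B"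
  and transpose_diff: "transpose (A - B) = transpose A - transpose B"
  for A B :: "real^'n^'m"
  by (simp_all add: transpose_def vec_eq_iff)

lemma sum_matrix_vector_mult: "sum f I *v x = (\<Sum>i\<in>I. f i *v x)"
  for f :: "'i \<Rightarrow> real^'n^'m"
  by (induction I rule: infinite_finite_induct) (simp_all add: matrix_vector_mult_add_rdistrib)

lemma matrix_vector_mult_sum: "(A :: real^'n^'m) *v sum f I = (\<Sum>i\<in>I. A *v f i)"
  by (induction I rule: infinite_finite_induct) (simp_all add: matrix_vector_right_distrib)

lemma uminus_matrix_vector_mult: "(- A) *v x = - (A *v x)"
  for A :: "real^'n^'m"
  by (simp add: matrix_vector_mult_def vec_eq_iff sum_negf)

lemma matrix_vector_mult_uminus: "A *v (- x) = - (A *v x)"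
  for A :: "real^'n^'m"
  by (simp add: matrix_vector_mult_def vec_eq_iff sum_negf)

lemma vstack_nonneg_iff: "0 \<le> vstack x y \<longleftrightarrow> 0 \<le> x \<and> 0 \<le> y"
  by (auto simp: vstack_def less_eq_vec_def split: sum.splits)

lemma sum_UNIV_Plus:
  fixes f :: "'a::finite + 'b::finite \<Rightarrow> real"
  shows "sum f UNIV = (\<Sum>a\<in>UNIV. f (Inl a)) + (\<Sum>b\<in>UNIV. f (Inr b))"
  by (simp flip: UNIV_Plus_UNIV add: sum.Plus)

lemma inner_vstack: "vstack x y \<bullet> vstack x' y' = x \<bullet> x' + y \<bullet> y'"
  by (simp add: inner_vec_def sum_UNIV_Plus vstack_def)

lemma vstack_add: "vstack x y + vstack x' y' = vstack (x + x') (y + y')"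
  by (auto simp: vstack_def vec_eq_iff split: sum.splits)

lemma rowstack_mult: "rowstack X Y *v z = vstack (X *v z) (Y *v z)"
  by (auto simp: vec_eq_iff rowstack_def vstack_def matrix_vector_mult_def split: sum.splits)

lemma colstack_mult_vstack: "colstack X Y *v vstack x y = X *v x + Y *v y"
  by (simp add: vec_eq_iff colstack_def vstack_def matrix_vector_mult_def sum_UNIV_Plus)

lemma inner_nonneg_nonneg:
  fixes a b :: "real^'n"
  assumes "0 \<le> a" and "0 \<le> b"
  shows "0 \<le> a \<bullet> b"
  using assms by (auto simp: inner_vec_def less_eq_vec_def intro!: sum_nonneg)

section \<open>Linear recursions\<close>

lemma prod_down_self: "prod_down f a a = mat 1"
  by (cases a) simp_all

lemma prod_up_self: "prod_up f a a = mat 1"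
  by (cases a) simp_all

lemma prod_up_transpose:
  "prod_up (\<lambda>j. transpose (f j)) a b = transpose (prod_down f a b)"
  by (induction b) (simp_all add: matrix_transpose_mul)

lemma prod_down_split:
  assumes "a \<le> b" and "b \<le> c"
  shows "prod_down f a c = prod_down f b c ** prod_down f a b"
  using assms(2)
proof (induction c rule: dec_induct)
  case base
  then show ?case by (simp add: prod_down_self)
next
  case (step c)
  then show ?case using assms(1) by (simp add: matrix_mul_assoc)
qed

text \<open>\<open>prod_up\<close> is built by adding factors on the right, whereas unrolling a
  backward recursion adds them on the left.\<close>

lemma prod_up_Suc_left:
  assumes "a < b"
  shows "prod_up f a b = f a ** prod_up f (Suc a) b"
proof -
  have "Suc a \<le> b" using assms by simp
  then show ?thesis
  proof (induction b rule: dec_induct)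
    case base
    show ?case by (simp add: prod_up_self)
  next
    case (step b)
    then show ?case by (simp add: matrix_mul_assoc)
  qed
qed

text \<open>Discrete variation of constants. It serves both for state deviations (\<open>F\<close>
  is \<open>Amat g\<close>, zero start) and for \<open>xstar\<close> (\<open>F\<close> is
  \<open>Abar g\<close>).\<close>

lemma forward_recursion_sum:
  fixes x :: "nat \<Rightarrow> real^'n"
  assumes "\<And>j. j < k \<Longrightarrow> x (Suc j) = F j *v x j + f j"
  shows "x k = prod_down F 0 k *v x 0 + (\<Sum>l<k. prod_down F (Suc l) k *v f l)"
  using assms
proof (induction k)
  case 0
  then show ?case by simp
next
  case (Suc k)
  have "F k *v (\<Sum>l<k. prod_down F (Suc l) k *v f l)
      = (\<Sum>l<k. prod_down F (Suc l) (Suc k) *v f l)"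
    by (simp add: matrix_vector_mult_sum matrix_vector_mul_assoc)
  moreover have "x k = prod_down F 0 k *v x 0 + (\<Sum>l<k. prod_down F (Suc l) k *v f l)"
    using Suc by simp
  ultimately show ?case
    using Suc.prems[of k]
    by (simp add: matrix_vector_right_distrib prod_down_self matrix_vector_mul_assoc)
qed

text \<open>The adjoint counterpart, used for \<open>beta\<close>. As \<open>prod_up\<close>
  excludes its upper bound, the bounds \<open>Suc k\<close> and \<open>Suc \<tau>\<close> give the
  factors with indices k+1 to \<tau>.\<close>

lemma backward_recursion_sum:
  fixes b :: "nat \<Rightarrow> real^'n"
  assumes "b K = c K" and "\<And>j. j < K \<Longrightarrow> b j = c j + G (Suc j) *v b (Suc j)" and "k \<le> K"
  shows "b k = (\<Sum>\<tau>=k..K. prod_up G (Suc k) (Suc \<tau>) *v c \<tau>)"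
  using assms(3)
proof (induction k rule: inc_induct)
  case base
  then show ?case using assms(1) by (simp add: prod_up_self)
next
  case (step k)
  have "G (Suc k) *v b (Suc k)
      = (\<Sum>\<tau>=Suc k..K. prod_up G (Suc k) (Suc \<tau>) *v c \<tau>)"
    unfolding step.IH matrix_vector_mult_sum
    by (rule sum.cong) (simp_all only: matrix_vector_mul_assoc prod_up_Suc_left[of "Suc k"]
        atLeastAtMost_iff less_Suc_eq_le)
  then show ?case
    using step.hyps assms(2)[of k] by (simp add: sum.atLeast_Suc_atMost[of k] prod_up_self)
qed

section \<open>The quadratic form of the matrix H\<close>

text \<open>Passes from the scalar index pairs of \<open>bigH\<close> to inner products with whole
  blocks.\<close>

lemma sum_block_entries:
  fixes f :: "nat \<Rightarrow> real^'a" and h :: "nat \<Rightarrow> real^'b" and X :: "nat \<Rightarrow> nat \<Rightarrow> real^'b^'a"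
  shows "(\<Sum>(k, a)\<in>I \<times> UNIV. \<Sum>(l, b)\<in>J \<times> UNIV. f k $ a * X k l $ a $ b * h l $ b)
    = (\<Sum>k\<in>I. \<Sum>l\<in>J. f k \<bullet> (X k l *v h l))"
proof -
  have "(\<Sum>a\<in>UNIV. \<Sum>l\<in>J. \<Sum>b\<in>UNIV. f k $ a * X k l $ a $ b * h l $ b)
      = (\<Sum>l\<in>J. f k \<bullet> (X k l *v h l))" for k
    by (subst sum.swap) (simp add: inner_vec_def matrix_vector_mult_def sum_distrib_left mult.assoc)
  then show ?thesis
    by (simp add: sum.cartesian_product[symmetric])
qed

text \<open>Completion of the square in expanded form. With \<Psi> = B'EAx, the Riccati expression
  \<open>E0\<close> subtracts \<Psi>'T^-1 \<Psi>, which the last term restores; for symmetric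
  invertible T the terms after the first form (u + T^-1 \<Psi>)'T(u + T^-1 \<Psi>).\<close>

lemma riccati_step:
  fixes A E Q R :: "real^_^_" and B :: "real^'m^'n" and x :: "real^'n" and u :: "real^'m"
  assumes E: "transpose E = E"
    and T: "T = R + transpose B ** E ** B"
    and E0: "E0 = transpose A ** E ** A + Q
        - transpose A ** E ** B ** matrix_inv T ** transpose B ** E ** A"
  shows "(A *v x + B *v u) \<bullet> (E *v (A *v x + B *v u)) + x \<bullet> (Q *v x) + u \<bullet> (R *v u)
    = x \<bullet> (E0 *v x) + u \<bullet> (T *v u) + 2 * (u \<bullet> (transpose B *v (E *v (A *v x))))
      + (transpose B *v (E *v (A *v x))) \<bullet> (matrix_inv T *v (transpose B *v (E *v (A *v x))))"
proof -
  have sym: "(E *v y) \<bullet> z = y \<bullet> (E *v z)" for y z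
    by (metis E inner_transpose_mult)
  have "x \<bullet> (transpose A *v (E *v (B *v z))) = (transpose B *v (E *v (A *v x))) \<bullet> z" for z
    by (metis inner_transpose_mult inner_commute sym)
  then show ?thesis
    unfolding T E0
    by (simp add: matrix_vector_mult_add_rdistrib matrix_vector_mult_diff_rdistrib
        matrix_vector_right_distrib matrix_vector_mul_assoc[symmetric] inner_add_left
        inner_add_right inner_diff_right inner_transpose_mult)
      (metis inner_commute sym)
qed

lemma Emat_sym:
  assumes Q: "\<forall>k\<le>horizon g. transpose (ocpQ g k) = ocpQ g k"
    and R: "\<forall>k<horizon g. transpose (ocpR g k) = ocpR g k"
    and inv: "\<forall>k<horizon g. invertible (Tmat g k)"
    and "k \<le> horizon g"
  shows "transpose (Emat g k) = Emat g k"
  using assms(4)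
proof (induction k rule: inc_induct)
  case base
  then show ?case using Q by (simp add: Emat.simps)
next
  case (step k)
  have "transpose (Tmat g k) = Tmat g k"
    using step R by (simp add: Tmat_def transpose_add matrix_transpose_mul matrix_mul_assoc)
  then have "transpose (matrix_inv (Tmat g k)) = matrix_inv (Tmat g k)"
    using inv step by (simp add: transpose_matrix_inv)
  then show ?case
    using step Q unfolding Emat.simps[of g k] Tmat_def
    by (simp add: transpose_add transpose_diff matrix_transpose_mul matrix_mul_assoc)
qed

lemma Tmat_sym:
  assumes "\<forall>k\<le>horizon g. transpose (ocpQ g k) = ocpQ g k"
    and R: "\<forall>k<horizon g. transpose (ocpR g k) = ocpR g k"
    and "\<forall>k<horizon g. invertible (Tmat g k)"
    and k: "k < horizon g"
  shows "transpose (Tmat g k) = Tmat g k"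
proof -
  have "transpose (Emat g (Suc k)) = Emat g (Suc k)"
    using Emat_sym[OF assms(1-3), of "Suc k"] k by simp
  then show ?thesis
    using R k by (simp add: Tmat_def transpose_add matrix_transpose_mul matrix_mul_assoc)
qed

lemma Ups_split:
  assumes "l \<le> k" and "k \<le> \<tau>"
  shows "Ups g l \<tau> = Ups g k \<tau> ** prod_down (Amat g) (Suc l) (Suc k)"
  using prod_down_split[of "Suc l" "Suc k" "Suc \<tau>" "Amat g"] assms
  by (simp only: Ups_def matrix_mul_assoc[symmetric] Suc_le_mono)

lemma inner_UpsSum:
  "y \<bullet> (UpsSum g k *v z)
    = (\<Sum>\<tau>\<in>{Suc k..<horizon g}. (Ups g k \<tau> *v y) \<bullet> (matrix_inv (Tmat g \<tau>) *v (Ups g k \<tau> *v z)))"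
  by (simp add: UpsSum_def sum_matrix_vector_mult inner_sum_right inner_transpose_mult
      matrix_vector_mul_assoc[symmetric])

lemma inner_Ylow:
  assumes "l < k"
  shows "f \<bullet> (Ylow g k l *v h) = f \<bullet> (Ups g l k *v (ocpB g l *v h))
    + (\<Sum>\<tau>\<in>{Suc k..<horizon g}. (Ups g k \<tau> *v (ocpB g k *v f))
        \<bullet> (matrix_inv (Tmat g \<tau>) *v (Ups g l \<tau> *v (ocpB g l *v h))))"
proof -
  \<comment> \<open>The transition from l to \<tau> factors through the intermediate time k, so the
    transition product in \<open>Ylow\<close> merges with \<open>Ups g k \<tau>\<close>.\<close>
  have "Ups g k \<tau> *v (prod_down (Amat g) (Suc l) (Suc k) *v z) = Ups g l \<tau> *v z"
    if "\<tau> \<in> {Suc k..<horizon g}" for \<tau> z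
    using that assms Ups_split[of l k \<tau> g] by (simp add: matrix_vector_mul_assoc del: prod_down.simps)
  then show ?thesis
    unfolding Ylow_def matrix_vector_mult_add_rdistrib inner_add_right
    by (simp add: matrix_vector_mul_assoc[symmetric] inner_transpose_mult inner_UpsSum Ups_def[of g l k]
        del: prod_down.simps)
qed

text \<open>One formula for the diagonal, lower and upper blocks. The sum runs over all \<tau> below
  the horizon, with indicators cutting it down to \<tau> > max k l, so that its range is independent
  of k and l and summations can be interchanged.\<close>

lemma inner_Ymat:
  assumes sym: "\<And>\<tau>. \<tau> < horizon g \<Longrightarrow> transpose (matrix_inv (Tmat g \<tau>)) = matrix_inv (Tmat g \<tau>)"
  shows "f \<bullet> (Ymat g k l *v h)
    = (if k = l then f \<bullet> (Tmat g k *v h) else 0)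
    + (if l < k then f \<bullet> (Ups g l k *v (ocpB g l *v h)) else 0)
    + (if k < l then (Ups g k l *v (ocpB g k *v f)) \<bullet> h else 0)
    + (\<Sum>\<tau><horizon g. (if k < \<tau> then Ups g k \<tau> *v (ocpB g k *v f) else 0)
        \<bullet> (matrix_inv (Tmat g \<tau>) *v (if l < \<tau> then Ups g l \<tau> *v (ocpB g l *v h) else 0)))"
proof -
  have sum: "(\<Sum>\<tau><horizon g. (if k < \<tau> then Ups g k \<tau> *v (ocpB g k *v f) else 0)
        \<bullet> (matrix_inv (Tmat g \<tau>) *v (if l < \<tau> then Ups g l \<tau> *v (ocpB g l *v h) else 0)))
    = (\<Sum>\<tau>\<in>{Suc (max k l)..<horizon g}. (Ups g k \<tau> *v (ocpB g k *v f))
        \<bullet> (matrix_inv (Tmat g \<tau>) *v (Ups g l \<tau> *v (ocpB g l *v h))))"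
    by (rule sum.mono_neutral_cong_right) auto
  consider "k = l" | "l < k" | "k < l" by linarith
  then show ?thesis
  proof cases
    case 1
    then show ?thesis
      unfolding sum
      by (simp add: Ymat_def matrix_vector_mult_add_rdistrib matrix_vector_mul_assoc[symmetric]
          inner_add_right inner_transpose_mult inner_UpsSum)
  next
    case 2
    then show ?thesis
      unfolding sum by (simp add: Ymat_def inner_Ylow max_def)
  next
    case 3
    \<comment> \<open>An upper block is the transpose of a lower one, which swaps the two arguments
      of the form given by T^-1; symmetry swaps them back.\<close>
    have "y \<bullet> (matrix_inv (Tmat g \<tau>) *v z) = z \<bullet> (matrix_inv (Tmat g \<tau>) *v y)"
      if "\<tau> < horizon g" for y z \<tau>
      by (metis sym[OF that] inner_transpose_mult inner_commute)
    then show ?thesis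
      using 3 inner_Ylow[of k l h g f] unfolding sum
      by (simp add: Ymat_def inner_transpose_mult max_def inner_commute[of h])
  qed
qed

lemma inner_Cmat:
  "f \<bullet> (Cmat g l k *v h)
    = (if l < k then (prod_down (Amat g) (Suc l) k *v (ocpB g l *v f)) \<bullet> (ocpL g k *v h) else 0)"
proof -
  consider "Suc l < k" | "Suc l = k" | "k \<le> l" by linarith
  then show ?thesis
    by cases (auto simp: Cmat_def prod_up_transpose matrix_vector_mul_assoc[symmetric]
        inner_transpose_mult prod_down_self simp del: prod_down.simps)
qed

text \<open>Summing the blocks of Y over all controls reproduces the right-hand sides of
  \<open>riccati_step\<close>; summed over time, the terms x_k'E_k x_k telescope and leave the state
  and control costs.\<close>

lemma Ymat_quadratic_form:
  fixes g :: "('n::finite, 'm::finite, 's::finite, 'c::finite, 'p::finite) nzdg1"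
  assumes Q: "\<forall>k\<le>horizon g. transpose (ocpQ g k) = ocpQ g k"
    and R: "\<forall>k<horizon g. transpose (ocpR g k) = ocpR g k"
    and inv: "\<forall>k<horizon g. invertible (Tmat g k)"
    and x0: "x 0 = 0"
    and x: "\<And>k. k < horizon g \<Longrightarrow> x (Suc k) = Amat g k *v x k + ocpB g k *v w k"
  shows "(\<Sum>k<horizon g. \<Sum>l<horizon g. w k \<bullet> (Ymat g k l *v w l))
    = x (horizon g) \<bullet> (ocpQ g (horizon g) *v x (horizon g))
      + (\<Sum>k<horizon g. x k \<bullet> (ocpQ g k *v x k) + w k \<bullet> (ocpR g k *v w k))"
proof -
  let ?K = "horizon g"
  \<comment> \<open>\<open>W k \<tau>\<close> is the contribution of the control at time k to \<Psi>
    at time \<tau>. It vanishes for k \<ge> \<tau>, since x_\<tau> depends only on earlier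
    controls.\<close>
  define W where "W k \<tau> = (if k < \<tau> then Ups g k \<tau> *v (ocpB g k *v w k) else 0)" for k \<tau>
  define \<Psi> where "\<Psi> \<tau> = transpose (ocpB g \<tau>) *v (Emat g (Suc \<tau>) *v (Amat g \<tau> *v x \<tau>))" for \<tau>
  have W_sum: "(\<Sum>l<?K. W l \<tau>) = \<Psi> \<tau>" if \<tau>: "\<tau> < ?K" for \<tau>
  proof -
    have "(\<Sum>l<?K. W l \<tau>) = (\<Sum>l<\<tau>. Ups g l \<tau> *v (ocpB g l *v w l))"
      using \<tau> by (intro sum.mono_neutral_cong_right) (auto simp: W_def)
    also have "\<dots> = (\<Sum>l<\<tau>. transpose (ocpB g \<tau>) *v (Emat g (Suc \<tau>) *v (Amat g \<tau> *v
        (prod_down (Amat g) (Suc l) \<tau> *v (ocpB g l *v w l)))))"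
      by (rule sum.cong) (simp_all add: Ups_def matrix_vector_mul_assoc[symmetric])
    also have "\<dots> = \<Psi> \<tau>"
      using forward_recursion_sum[of \<tau> x "Amat g" "\<lambda>k. ocpB g k *v w k"] x x0 \<tau>
      by (simp add: \<Psi>_def matrix_vector_mult_sum)
    finally show ?thesis .
  qed
  have sym: "transpose (matrix_inv (Tmat g \<tau>)) = matrix_inv (Tmat g \<tau>)" if "\<tau> < ?K" for \<tau>
    using that inv Tmat_sym[OF Q R inv] by (simp add: transpose_matrix_inv)
  have "(\<Sum>k<?K. \<Sum>l<?K. w k \<bullet> (Ymat g k l *v w l))
    = (\<Sum>k<?K. \<Sum>l<?K. (if k = l then w k \<bullet> (Tmat g k *v w l) else 0) + w k \<bullet> W l k + W k l \<bullet> w l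
        + (\<Sum>\<tau><?K. W k \<tau> \<bullet> (matrix_inv (Tmat g \<tau>) *v W l \<tau>)))"
    by (intro sum.cong refl, subst inner_Ymat[OF sym]) (simp_all add: W_def)
  also have "\<dots> = (\<Sum>k<?K. w k \<bullet> (Tmat g k *v w k)) + (\<Sum>k<?K. \<Sum>l<?K. w k \<bullet> W l k)
      + (\<Sum>k<?K. \<Sum>l<?K. W k l \<bullet> w l)
      + (\<Sum>k<?K. \<Sum>l<?K. \<Sum>\<tau><?K. W k \<tau> \<bullet> (matrix_inv (Tmat g \<tau>) *v W l \<tau>))"
    by (simp add: sum.distrib)
  also have "(\<Sum>k<?K. \<Sum>l<?K. w k \<bullet> W l k) = (\<Sum>k<?K. w k \<bullet> \<Psi> k)"
    by (simp flip: inner_sum_right add: W_sum)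
  also have "(\<Sum>k<?K. \<Sum>l<?K. W k l \<bullet> w l) = (\<Sum>k<?K. w k \<bullet> \<Psi> k)"
    by (subst sum.swap, simp flip: inner_sum_left add: W_sum) (simp add: inner_commute)
  \<comment> \<open>Once the sum over \<tau> is outermost, bilinearity collapses the inner double
    sum to the form of T^-1 at \<Psi>.\<close>
  also have "(\<Sum>k<?K. \<Sum>l<?K. \<Sum>\<tau><?K. W k \<tau> \<bullet> (matrix_inv (Tmat g \<tau>) *v W l \<tau>))
      = (\<Sum>k<?K. \<Sum>\<tau><?K. \<Sum>l<?K. W k \<tau> \<bullet> (matrix_inv (Tmat g \<tau>) *v W l \<tau>))"
    by (intro sum.cong refl sum.swap)
  also have "\<dots> = (\<Sum>\<tau><?K. \<Sum>k<?K. \<Sum>l<?K. W k \<tau> \<bullet> (matrix_inv (Tmat g \<tau>) *v W l \<tau>))"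
    by (rule sum.swap)
  also have "\<dots> = (\<Sum>\<tau><?K. \<Psi> \<tau> \<bullet> (matrix_inv (Tmat g \<tau>) *v \<Psi> \<tau>))"
    by (simp flip: inner_sum_left inner_sum_right matrix_vector_mult_sum add: W_sum)
  finally have Y: "(\<Sum>k<?K. \<Sum>l<?K. w k \<bullet> (Ymat g k l *v w l))
    = (\<Sum>k<?K. w k \<bullet> (Tmat g k *v w k) + 2 * (w k \<bullet> \<Psi> k)
        + \<Psi> k \<bullet> (matrix_inv (Tmat g k) *v \<Psi> k))"
    by (simp add: sum.distrib sum_distrib_left)
  have "x (Suc k) \<bullet> (Emat g (Suc k) *v x (Suc k)) + x k \<bullet> (ocpQ g k *v x k) + w k \<bullet> (ocpR g k *v w k)
      = x k \<bullet> (Emat g k *v x k) + w k \<bullet> (Tmat g k *v w k) + 2 * (w k \<bullet> \<Psi> k)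
        + \<Psi> k \<bullet> (matrix_inv (Tmat g k) *v \<Psi> k)" if "k < ?K" for k
    unfolding x[OF that] \<Psi>_def
    by (rule riccati_step) (use that Emat_sym[OF Q R inv, of "Suc k"] in
        \<open>simp_all add: Tmat_def Emat.simps[of g k]\<close>)
  then have "(\<Sum>k<?K. w k \<bullet> (Tmat g k *v w k) + 2 * (w k \<bullet> \<Psi> k)
        + \<Psi> k \<bullet> (matrix_inv (Tmat g k) *v \<Psi> k))
      = (\<Sum>k<?K. (x (Suc k) \<bullet> (Emat g (Suc k) *v x (Suc k)) - x k \<bullet> (Emat g k *v x k))
          + (x k \<bullet> (ocpQ g k *v x k) + w k \<bullet> (ocpR g k *v w k)))"
    by (intro sum.cong) (simp_all add: algebra_simps)
  also have "\<dots> = x ?K \<bullet> (Emat g ?K *v x ?K)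
      + (\<Sum>k<?K. x k \<bullet> (ocpQ g k *v x k) + w k \<bullet> (ocpR g k *v w k))"
    unfolding sum.distrib[of "\<lambda>k. _ k - _ k"]
      sum_lessThan_telescope[of "\<lambda>k. x k \<bullet> (Emat g k *v x k)"] by (simp add: x0)
  finally show ?thesis
    using Y by (simp add: Emat.simps[of g ?K])
qed

text \<open>Block column k of C collects the effect of all earlier controls on x_k, paired with L_k;
  variation of constants from the zero initial state sums it up.\<close>

lemma Cmat_bilinear_form:
  assumes "x 0 = 0"
    and "\<And>k. k < horizon g \<Longrightarrow> x (Suc k) = Amat g k *v x k + ocpB g k *v w k"
  shows "(\<Sum>l<horizon g. \<Sum>k\<le>horizon g. w l \<bullet> (Cmat g l k *v s k))
    = (\<Sum>k\<le>horizon g. x k \<bullet> (ocpL g k *v s k))"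
proof -
  have "(\<Sum>l<horizon g. w l \<bullet> (Cmat g l k *v s k)) = x k \<bullet> (ocpL g k *v s k)" if "k \<le> horizon g" for k
  proof -
    have "(\<Sum>l<horizon g. w l \<bullet> (Cmat g l k *v s k))
        = (\<Sum>l<k. (prod_down (Amat g) (Suc l) k *v (ocpB g l *v w l)) \<bullet> (ocpL g k *v s k))"
      using that by (intro sum.mono_neutral_cong_right) (auto simp: inner_Cmat)
    also have "\<dots> = x k \<bullet> (ocpL g k *v s k)"
      using forward_recursion_sum[of k x "Amat g" "\<lambda>k. ocpB g k *v w k"] assms that
      by (simp add: inner_sum_left)
    finally show ?thesis .
  qed
  then show ?thesis
    by (subst sum.swap) simp
qed

text \<open>The blocks C and C' contribute the same sum, whence the factor 2 of the mixed
  term.\<close>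

lemma bigH_quadratic_form:
  fixes g :: "('n::finite, 'm::finite, 's::finite, 'c::finite, 'p::finite) nzdg1"
  assumes "\<forall>k\<le>horizon g. transpose (ocpQ g k) = ocpQ g k"
    and "\<forall>k<horizon g. transpose (ocpR g k) = ocpR g k"
    and "\<forall>k<horizon g. invertible (Tmat g k)"
    and "x 0 = 0"
    and "\<And>k. k < horizon g \<Longrightarrow> x (Suc k) = Amat g k *v x k + ocpB g k *v w k"
    and z: "z = case_sum (\<lambda>(k, a). w k $ a) (\<lambda>(k, b). s k $ b)"
  shows "(\<Sum>i\<in>bigH_index g. \<Sum>j\<in>bigH_index g. z i * bigH g i j * z j)
    = x (horizon g) \<bullet> (ocpQ g (horizon g) *v x (horizon g))
      + (\<Sum>k<horizon g. x k \<bullet> (ocpQ g k *v x k) + w k \<bullet> (ocpR g k *v w k))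
      + (\<Sum>k\<le>horizon g. s k \<bullet> (ocpD g k *v s k) + 2 * (x k \<bullet> (ocpL g k *v s k)))"
proof -
  let ?K = "horizon g"
  \<comment> \<open>The equations of \<open>bigH\<close> match explicit pairs; after
    \<open>case_prod_unfold\<close> the indices are pair variables, so projections are used
    instead.\<close>
  have bigH_entry:
    "bigH g (Inl p) (Inl q) = Ymat g (fst p) (fst q) $ snd p $ snd q"
    "bigH g (Inl p) (Inr q') = Cmat g (fst p) (fst q') $ snd p $ snd q'"
    "bigH g (Inr p') (Inl q) = transpose (Cmat g (fst q) (fst p')) $ snd p' $ snd q"
    "bigH g (Inr p') (Inr q') = bdiag (ocpD g) (fst p') (fst q') $ snd p' $ snd q'" for p q p' q'
    by (cases p; cases q; cases p'; cases q'; simp)+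
  have "(\<Sum>i\<in>bigH_index g. \<Sum>j\<in>bigH_index g. z i * bigH g i j * z j)
    = (\<Sum>(k, a)\<in>{..<?K} \<times> UNIV. \<Sum>(l, b)\<in>{..<?K} \<times> UNIV. w k $ a * Ymat g k l $ a $ b * w l $ b)
    + (\<Sum>(k, a)\<in>{..<?K} \<times> UNIV. \<Sum>(l, b)\<in>{..?K} \<times> UNIV. w k $ a * Cmat g k l $ a $ b * s l $ b)
    + (\<Sum>(k, a)\<in>{..?K} \<times> UNIV. \<Sum>(l, b)\<in>{..<?K} \<times> UNIV.
        s k $ a * transpose (Cmat g l k) $ a $ b * w l $ b)
    + (\<Sum>(k, a)\<in>{..?K} \<times> UNIV. \<Sum>(l, b)\<in>{..?K} \<times> UNIV.
        s k $ a * bdiag (ocpD g) k l $ a $ b * s l $ b)"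
    by (simp add: bigH_index_def sum.Plus z sum.distrib case_prod_unfold bigH_entry)
  also have "\<dots> = (\<Sum>k<?K. \<Sum>l<?K. w k \<bullet> (Ymat g k l *v w l))
    + (\<Sum>k<?K. \<Sum>l\<le>?K. w k \<bullet> (Cmat g k l *v s l))
    + (\<Sum>k\<le>?K. \<Sum>l<?K. s k \<bullet> (transpose (Cmat g l k) *v w l))
    + (\<Sum>k\<le>?K. \<Sum>l\<le>?K. s k \<bullet> (bdiag (ocpD g) k l *v s l))"
    unfolding sum_block_entries sum_block_entries[where X = "\<lambda>k l. transpose (Cmat g l k)"] ..
  also have "(\<Sum>k\<le>?K. \<Sum>l<?K. s k \<bullet> (transpose (Cmat g l k) *v w l))
      = (\<Sum>k<?K. \<Sum>l\<le>?K. w k \<bullet> (Cmat g k l *v s l))"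
    by (subst sum.swap) (simp add: inner_transpose_mult inner_commute)
  also have "(\<Sum>k\<le>?K. \<Sum>l\<le>?K. s k \<bullet> (bdiag (ocpD g) k l *v s l))
      = (\<Sum>k\<le>?K. s k \<bullet> (ocpD g k *v s k))"
    by (simp add: bdiag_def if_distrib[of "\<lambda>X. _ \<bullet> (X *v _)"] cong: if_cong)
  finally show ?thesis
    by (simp add: Ymat_quadratic_form[OF assms(1-5)] Cmat_bilinear_form[OF assms(4,5)]
        sum.distrib sum_distrib_left)
qed

section \<open>The controlled trajectory\<close>

text \<open>Each coordinate has exactly one owner, so the sum over players picks for column a the
  matrix of the owner of a.\<close>

lemma step_eq: "step g k x u = Amat g k *v x + ocpB g k *v u"
proof -
  have "(\<Sum>i\<in>UNIV. Bmat g k i *v block (own_u g) i u) = ocpB g k *v u"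
    by (simp add: vec_eq_iff matrix_vector_mult_def block_def ocpB_def, subst sum.swap)
      (simp add: if_distrib[of "\<lambda>y. _ * y"] cong: if_cong)
  then show ?thesis by (simp add: step_def)
qed

lemma trajectory_diff_Suc:
  "trajectory g U (Suc k) - trajectory g u (Suc k)
    = Amat g k *v (trajectory g U k - trajectory g u k) + ocpB g k *v (U k - u k)"
  by (simp add: step_eq algebra_simps)

text \<open>Multiplying the explicit recursion by \<Gamma> = I + SH and moving the SH term to the
  right leaves S times the affine co-state at time k+1.\<close>

lemma xstar_implicit:
  assumes "invertible (Gam g k)"
  shows "xstar g v \<mu> (Suc k) = Amat g k *v xstar g v \<mu> k
    - Smat g k *v (Hric g (Suc k) *v xstar g v \<mu> (Suc k) + beta g v \<mu> (Suc k))"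
proof -
  have "Gam g k *v xstar g v \<mu> (Suc k) = Amat g k *v xstar g v \<mu> k - Smat g k *v beta g v \<mu> (Suc k)"
    using assms by (simp add: matrix_vector_mul_assoc matrix_inv_mult)
  then show ?thesis
    by (simp add: Gam_def matrix_vector_mult_add_rdistrib matrix_vector_right_distrib
        matrix_vector_mul_assoc[symmetric] algebra_simps del: xstar.simps)
qed

text \<open>Since S = B R^-1 B', the implicit recursion is the dynamics under \<open>ustar\<close>;
  hence \<open>xstar\<close> is the state that these controls actually produce.\<close>

lemma trajectory_ustar:
  assumes "\<forall>k<horizon g. invertible (Gam g k)" and "k \<le> horizon g"
  shows "trajectory g (ustar g v \<mu>) k = xstar g v \<mu> k"
  using assms(2)
proof (induction k)
  case 0
  then show ?case by simp
next
  case (Suc k)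
  then have "xstar g v \<mu> (Suc k) = Amat g k *v xstar g v \<mu> k + ocpB g k *v ustar g v \<mu> k"
    using xstar_implicit[of g k v \<mu>] assms(1)
    by (simp add: ustar_def Smat_def matrix_vector_mult_uminus matrix_vector_mul_assoc[symmetric]
        del: xstar.simps)
  then show ?case
    using Suc by (simp add: step_eq del: xstar.simps)
qed

text \<open>Inserting the recursion for x_{k+1} into A'(H x_{k+1} + \<beta>_{k+1}), the coefficients
  of x_k and \<beta>_{k+1} are exactly those in the definitions of H_k and G_{k+1}.\<close>

lemma costates_affine:
  assumes "\<forall>k<horizon g. invertible (Gam g k)"
  shows "costates g (xstar g v \<mu>) v \<mu> (\<lambda>k. Hric g k *v xstar g v \<mu> k + beta g v \<mu> k)"
proof -
  have "Hric g k *v xstar g v \<mu> k + beta g v \<mu> k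
      = ocpQ g k *v xstar g v \<mu> k + ocpp g k + ocpL g k *v v k - transpose (Mmat g k) *v \<mu> k
        + transpose (Amat g k) *v (Hric g (Suc k) *v xstar g v \<mu> (Suc k) + beta g v \<mu> (Suc k))"
    if "k < horizon g" for k
    using that unfolding Hric.simps[of g k] beta.simps[of g v \<mu> k] xstar.simps
    by (simp add: Gmat_def Gam_def[symmetric] matrix_vector_mult_add_rdistrib
        matrix_vector_mult_diff_rdistrib matrix_vector_right_distrib matrix_vector_mult_diff_distrib
        matrix_vector_mul_assoc[symmetric])
  then show ?thesis
    by (simp add: costates_def Let_def Hric.simps[of g "horizon g"] beta.simps[of g v \<mu> "horizon g"])
qed

section \<open>The complementarity problems\<close>

text \<open>Solve \<beta> backwards, insert it into the forward solution for the state, and swap the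
  sums over \<rho> \<le> k and \<tau> \<ge> \<rho>; for fixed \<tau> the index \<rho> then runs up
  to min k \<tau>.\<close>

lemma xstar_Phi:
  assumes "k \<le> horizon g"
  shows "xstar g v \<mu> k = Phi0 g k *v x_init g
    + (\<Sum>\<tau>=1..horizon g. Phi1 g k \<tau> *v (ocpp g \<tau> + ocpL g \<tau> *v v \<tau> - transpose (Mmat g \<tau>) *v \<mu> \<tau>))"
proof -
  let ?K = "horizon g"
  define c where "c \<tau> = ocpp g \<tau> + ocpL g \<tau> *v v \<tau> - transpose (Mmat g \<tau>) *v \<mu> \<tau>" for \<tau>
  define t where "t \<rho> \<tau> = phi g \<rho> k *v (Bbar g (\<rho> - 1) *v (psi g \<rho> \<tau> *v c \<tau>))" for \<rho> \<tau>
  have beta: "beta g v \<mu> \<rho> = (\<Sum>\<tau>=\<rho>..?K. psi g \<rho> \<tau> *v c \<tau>)" if "\<rho> \<le> ?K" for \<rho>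
    unfolding psi_def
    by (rule backward_recursion_sum) (use that in
        \<open>simp_all add: c_def beta.simps[of g v \<mu> ?K] beta.simps[of g v \<mu>]\<close>)
  have "xstar g v \<mu> (Suc j) = Abar g j *v xstar g v \<mu> j + Bbar g j *v beta g v \<mu> (Suc j)" for j
    by (simp add: Abar_def Bbar_def matrix_vector_mult_diff_distrib uminus_matrix_vector_mult
        matrix_vector_mul_assoc[symmetric])
  then have "xstar g v \<mu> k = Phi0 g k *v x_init g
      + (\<Sum>l<k. phi g (Suc l) k *v (Bbar g l *v beta g v \<mu> (Suc l)))"
    using forward_recursion_sum[of k "xstar g v \<mu>" "Abar g" "\<lambda>j. Bbar g j *v beta g v \<mu> (Suc j)"]
    by (simp add: Phi0_def phi_def del: xstar.simps(2))
  also have "(\<Sum>l<k. phi g (Suc l) k *v (Bbar g l *v beta g v \<mu> (Suc l)))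
      = (\<Sum>\<rho>=1..k. phi g \<rho> k *v (Bbar g (\<rho> - 1) *v beta g v \<mu> \<rho>))"
    by (simp add: sum.atLeast1_atMost_eq)
  also have "\<dots> = (\<Sum>\<rho>=1..k. \<Sum>\<tau>\<in>{\<tau>\<in>{1..?K}. \<rho> \<le> \<tau>}. t \<rho> \<tau>)"
  proof (rule sum.cong)
    fix \<rho> assume "\<rho> \<in> {1..k}"
    moreover from this have "{\<tau>\<in>{1..?K}. \<rho> \<le> \<tau>} = {\<rho>..?K}" by auto
    ultimately show "phi g \<rho> k *v (Bbar g (\<rho> - 1) *v beta g v \<mu> \<rho>)
        = (\<Sum>\<tau>\<in>{\<tau>\<in>{1..?K}. \<rho> \<le> \<tau>}. t \<rho> \<tau>)"
      using assms by (simp add: beta t_def matrix_vector_mult_sum)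
  qed simp
  also have "\<dots> = (\<Sum>\<tau>=1..?K. \<Sum>\<rho>\<in>{\<rho>\<in>{1..k}. \<rho> \<le> \<tau>}. t \<rho> \<tau>)"
    by (rule sum.swap_restrict) simp_all
  also have "\<dots> = (\<Sum>\<tau>=1..?K. Phi1 g k \<tau> *v c \<tau>)"
  proof (rule sum.cong)
    fix \<tau> :: nat
    have "{\<rho>\<in>{1..k}. \<rho> \<le> \<tau>} = {1..min k \<tau>}" by auto
    then show "(\<Sum>\<rho>\<in>{\<rho>\<in>{1..k}. \<rho> \<le> \<tau>}. t \<rho> \<tau>) = Phi1 g k \<tau> *v c \<tau>"
      by (simp add: t_def Phi1_def sum_matrix_vector_mult matrix_vector_mul_assoc[symmetric])
  qed simp
  finally show ?thesis by (simp add: c_def)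
qed

text \<open>\<open>LCP\<close> arises from the problems \<open>pLCP\<close> by eliminating the
  states with \<open>xstar_Phi\<close>; this undoes the elimination block by block.\<close>

lemma bigM_bigq_eq:
  fixes g :: "('n::finite, 'm::finite, 's::finite, 'c::finite, 'p::finite) nzdg1"
  assumes "k \<in> {1..horizon g}"
  shows "bmv {1..horizon g} (bigM g) (\<lambda>k. vstack (v k) (\<mu> k)) k + bigq g k
    = lcpM g k *v vstack (v k) (\<mu> k) + lcpq g k *v xstar g v \<mu> k + lcps g k"
proof -
  let ?I = "{1..horizon g}"
  have bdiag_sum: "(\<Sum>j\<in>?I. bdiag f k j *v h j) = f k *v h k"
    for f :: "nat \<Rightarrow> real^'a^'b" and h
    using assms by (simp add: bdiag_def if_distrib[of "\<lambda>X. X *v _"] cong: if_cong)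
  have "bmm ?I (bdiag (lcpq g)) (Phi2 g) k \<tau> *v y = lcpq g k *v (Phi2 g k \<tau> *v y)" for \<tau> y
    using bdiag_sum[of "lcpq g" "\<lambda>j. Phi2 g j \<tau> *v y"]
    by (simp add: bmm_def sum_matrix_vector_mult matrix_vector_mul_assoc[symmetric])
  then have M: "bmv ?I (bigM g) (\<lambda>k. vstack (v k) (\<mu> k)) k
    = lcpM g k *v vstack (v k) (\<mu> k)
      + lcpq g k *v (\<Sum>\<tau>\<in>?I. Phi1 g k \<tau> *v (ocpL g \<tau> *v v \<tau> - transpose (Mmat g \<tau>) *v \<mu> \<tau>))"
    by (simp add: bmv_def bigM_def matrix_vector_mult_add_rdistrib sum.distrib bdiag_sum
        matrix_vector_mult_sum Phi2_def matrix_vector_mul_assoc[symmetric] colstack_mult_vstack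
        uminus_matrix_vector_mult del: One_nat_def)
  have q: "bigq g k = lcpq g k *v (Phi0 g k *v x_init g + (\<Sum>\<tau>\<in>?I. Phi1 g k \<tau> *v ocpp g \<tau>)) + lcps g k"
    unfolding bigq_def bmv_def bdiag_sum ..
  have x: "xstar g v \<mu> k = Phi0 g k *v x_init g + (\<Sum>\<tau>\<in>?I. Phi1 g k \<tau> *v ocpp g \<tau>)
      + (\<Sum>\<tau>\<in>?I. Phi1 g k \<tau> *v (ocpL g \<tau> *v v \<tau> - transpose (Mmat g \<tau>) *v \<mu> \<tau>))"
    using assms
    by (simp add: xstar_Phi matrix_vector_right_distrib matrix_vector_mult_diff_distrib sum.distrib
        sum_subtractf)
  show ?thesis
    unfolding M q x by (simp add: matrix_vector_right_distrib)
qed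

lemma LCP_imp_pLCP:
  assumes "LCP g v \<mu>" and k: "k \<in> {1..horizon g}"
  shows "pLCP g k (xstar g v \<mu> k) (v k) (\<mu> k)"
proof -
  let ?I = "{1..horizon g}"
  define a where "a k = lcpM g k *v vstack (v k) (\<mu> k) + lcpq g k *v xstar g v \<mu> k + lcps g k" for k
  have a: "\<forall>k\<in>?I. 0 \<le> a k" and y: "\<forall>k\<in>?I. 0 \<le> vstack (v k) (\<mu> k)"
    and s: "(\<Sum>k\<in>?I. a k \<bullet> vstack (v k) (\<mu> k)) = 0"
    using assms(1) by (simp_all add: LCP_def Let_def bcomplementary_def bigM_bigq_eq a_def del: One_nat_def)
  \<comment> \<open>\<open>LCP\<close> only makes the sum over all times vanish, but every summand
    is a product of non-negative vectors.\<close>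
  have "a k \<bullet> vstack (v k) (\<mu> k) = 0"
    using sum_nonneg_eq_0_iff[of ?I "\<lambda>k. a k \<bullet> vstack (v k) (\<mu> k)"] a y s k
    by (simp add: inner_nonneg_nonneg)
  then show ?thesis
    using a y k by (simp add: pLCP_def complementary_def a_def)
qed

lemma pLCP_iff:
  "pLCP g k x v \<mu> \<longleftrightarrow>
    0 \<le> ocpD g k *v v - transpose (Nmat g k) *v \<mu> + transpose (ocpL g k) *v x + ocpd g k \<and>
    0 \<le> Nmat g k *v v + Mmat g k *v x + rvec g k \<and> 0 \<le> v \<and> 0 \<le> \<mu> \<and>
    (ocpD g k *v v - transpose (Nmat g k) *v \<mu> + transpose (ocpL g k) *v x + ocpd g k) \<bullet> v
      + (Nmat g k *v v + Mmat g k *v x + rvec g k) \<bullet> \<mu> = 0"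
  by (simp add: pLCP_def complementary_def lcpM_def lcpq_def lcps_def rowstack_mult
      colstack_mult_vstack vstack_add vstack_nonneg_iff inner_vstack uminus_matrix_vector_mult)

lemma pLCP_imp_constraints:
  assumes "pLCP g k x v \<mu>"
  shows "constraints g k x v"
  using assms by (simp add: pLCP_iff constraints_def add.commute add.left_commute)

text \<open>First-order optimality in variational form: any feasible pair makes both complementarity
  products non-negative, while at the solution their sum is zero. In the difference the terms with
  N'\<mu> cancel.\<close>

lemma pLCP_variational:
  assumes "pLCP g k x v \<mu>" and "constraints g k x' v'"
  shows "0 \<le> (Mmat g k *v (x' - x)) \<bullet> \<mu>
    + (v' - v) \<bullet> (ocpD g k *v v + ocpd g k + transpose (ocpL g k) *v x)"
proof -
  define a where "a = ocpD g k *v v - transpose (Nmat g k) *v \<mu> + transpose (ocpL g k) *v x + ocpd g k"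
  define c where "c = Nmat g k *v v + Mmat g k *v x + rvec g k"
  define c' where "c' = Nmat g k *v v' + Mmat g k *v x' + rvec g k"
  have "0 \<le> a" "a \<bullet> v + c \<bullet> \<mu> = 0" "0 \<le> \<mu>"
    using assms(1) by (simp_all add: pLCP_iff a_def c_def)
  moreover have "0 \<le> v'" "0 \<le> c'"
    using assms(2) by (simp_all add: constraints_def c'_def add.commute add.left_commute)
  ultimately have "0 \<le> a \<bullet> v' + c' \<bullet> \<mu> - (a \<bullet> v + c \<bullet> \<mu>)"
    by (simp add: inner_nonneg_nonneg)
  moreover have "(v' - v) \<bullet> (transpose (Nmat g k) *v \<mu>) = (Nmat g k *v v' - Nmat g k *v v) \<bullet> \<mu>"
    by (simp add: inner_transpose_mult matrix_vector_mult_diff_distrib)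
  ultimately show ?thesis
    by (simp add: a_def c_def c'_def inner_add_left inner_add_right inner_diff_left inner_diff_right
        matrix_vector_mult_diff_distrib inner_commute[of _ v] inner_commute[of _ v'])
qed

section \<open>Expansion of the cost of a player\<close>

lemma quadratic_expansion:
  fixes P :: "real^'n^'n"
  assumes "transpose P = P"
  shows "1/2 * ((x + h) \<bullet> (P *v (x + h))) = 1/2 * (x \<bullet> (P *v x)) + h \<bullet> (P *v x) + 1/2 * (h \<bullet> (P *v h))"
proof -
  have "x \<bullet> (P *v h) = h \<bullet> (P *v x)"
    by (metis assms inner_transpose_mult inner_commute)
  then show ?thesis
    by (simp add: matrix_vector_right_distrib inner_add_left inner_add_right field_simps)
qed

text \<open>An exact second-order Taylor expansion, the cost being quadratic in states and actions:
  the first bracket is linear in (y, w, s), the second quadratic.\<close>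

lemma cost_expansion:
  fixes g :: "('n::finite, 'm::finite, 's::finite, 'c::finite, 'p::finite) nzdg1"
  assumes "game_data g"
    and y: "\<And>k. y k = trajectory g U k - trajectory g u k"
    and w: "\<And>k. w k = U k - u k" and s: "\<And>k. s k = V k - v k"
    and x: "x = trajectory g u"
  shows "cost g i U V = cost g i u v
    + (y (horizon g) \<bullet> (Qmat g (horizon g) i *v x (horizon g) + pvec g (horizon g) i)
      + (\<Sum>k<horizon g. y k \<bullet> (Qmat g k i *v x k + pvec g k i) + w k \<bullet> (Rmat g k i *v u k))
      + (\<Sum>k\<le>horizon g. s k \<bullet> (Dmat g k i *v v k + dvec g k i + transpose (Lmat g k i) *v x k)
          + y k \<bullet> (Lmat g k i *v v k)))
    + 1/2 * (y (horizon g) \<bullet> (Qmat g (horizon g) i *v y (horizon g))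
      + (\<Sum>k<horizon g. y k \<bullet> (Qmat g k i *v y k) + w k \<bullet> (Rmat g k i *v w k))
      + (\<Sum>k\<le>horizon g. s k \<bullet> (Dmat g k i *v s k) + 2 * (y k \<bullet> (Lmat g k i *v s k))))"
proof -
  let ?K = "horizon g"
  have U: "U k = u k + w k" and V: "V k = v k + s k" and X: "trajectory g U k = x k + y k" for k
    by (simp_all add: w s y x)
  have Q: "transpose (Qmat g k i) = Qmat g k i" and D: "transpose (Dmat g k i) = Dmat g k i"
    if "k \<le> ?K" for k using assms(1) that by (simp_all add: game_data_def)
  have R: "transpose (Rmat g k i) = Rmat g k i" if "k < ?K" for k
    using assms(1) that by (simp add: game_data_def)
  have terminal: "1/2 * ((x ?K + y ?K) \<bullet> (Qmat g ?K i *v (x ?K + y ?K))) + pvec g ?K i \<bullet> (x ?K + y ?K)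
    = 1/2 * (x ?K \<bullet> (Qmat g ?K i *v x ?K)) + pvec g ?K i \<bullet> x ?K
      + y ?K \<bullet> (Qmat g ?K i *v x ?K + pvec g ?K i) + 1/2 * (y ?K \<bullet> (Qmat g ?K i *v y ?K))"
    by (subst quadratic_expansion[OF Q]) (simp_all add: inner_add_right inner_commute)
  have stage_u: "1/2 * ((x k + y k) \<bullet> (Qmat g k i *v (x k + y k))) + pvec g k i \<bullet> (x k + y k)
        + 1/2 * ((u k + w k) \<bullet> (Rmat g k i *v (u k + w k)))
    = (1/2 * (x k \<bullet> (Qmat g k i *v x k)) + pvec g k i \<bullet> x k + 1/2 * (u k \<bullet> (Rmat g k i *v u k)))
      + (y k \<bullet> (Qmat g k i *v x k + pvec g k i) + w k \<bullet> (Rmat g k i *v u k))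
      + 1/2 * (y k \<bullet> (Qmat g k i *v y k) + w k \<bullet> (Rmat g k i *v w k))" if "k < ?K" for k
    unfolding quadratic_expansion[OF Q[OF less_imp_le[OF that]]] quadratic_expansion[OF R[OF that]]
    by (simp add: inner_add_right inner_commute[of "pvec g k i"])
  have stage_v: "1/2 * ((v k + s k) \<bullet> (Dmat g k i *v (v k + s k))) + dvec g k i \<bullet> (v k + s k)
        + (x k + y k) \<bullet> (Lmat g k i *v (v k + s k))
    = (1/2 * (v k \<bullet> (Dmat g k i *v v k)) + dvec g k i \<bullet> v k + x k \<bullet> (Lmat g k i *v v k))
      + (s k \<bullet> (Dmat g k i *v v k + dvec g k i + transpose (Lmat g k i) *v x k)
          + y k \<bullet> (Lmat g k i *v v k))
      + 1/2 * (s k \<bullet> (Dmat g k i *v s k) + 2 * (y k \<bullet> (Lmat g k i *v s k)))" if "k \<le> ?K" for k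
    unfolding quadratic_expansion[OF D[OF that]]
    by (simp add: inner_add_left inner_add_right matrix_vector_right_distrib
        inner_transpose_mult inner_commute[of "dvec g k i"] inner_commute[of "x k"])
  show ?thesis
    unfolding cost_def Let_def U V X terminal x[symmetric]
    using sum.cong[OF refl stage_u, of "{..<?K}" "\<lambda>k. k"] sum.cong[OF refl stage_v, of "{..?K}" "\<lambda>k. k"]
    by (simp add: sum.distrib sum_distrib_left distrib_left)
qed

lemma linear_part_nonneg:
  assumes cs: "costates g x v \<mu> l"
    and Ru: "\<And>k. k < horizon g \<Longrightarrow> ocpR g k *v u k = - (transpose (ocpB g k) *v l (Suc k))"
    and y0: "y 0 = 0"
    and y: "\<And>k. k < horizon g \<Longrightarrow> y (Suc k) = Amat g k *v y k + ocpB g k *v w k"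
    and pL: "\<And>k. k \<le> horizon g \<Longrightarrow> pLCP g k (x k) (v k) (\<mu> k)"
    and con: "\<And>k. k \<le> horizon g \<Longrightarrow> constraints g k (x k + y k) (v k + s k)"
  shows "0 \<le> y (horizon g) \<bullet> (ocpQ g (horizon g) *v x (horizon g) + ocpp g (horizon g))
      + (\<Sum>k<horizon g. y k \<bullet> (ocpQ g k *v x k + ocpp g k) + w k \<bullet> (ocpR g k *v u k))
      + (\<Sum>k\<le>horizon g. s k \<bullet> (ocpD g k *v v k + ocpd g k + transpose (ocpL g k) *v x k)
          + y k \<bullet> (ocpL g k *v v k))"
    (is "0 \<le> ?T + ?U + ?V")
proof -
  let ?K = "horizon g"
  \<comment> \<open>The co-state equation and the condition on R_k u_k combine A_k y_k + B_k w_k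
    into y_{k+1}, which gives the telescoping difference.\<close>
  have stage: "y k \<bullet> (ocpQ g k *v x k + ocpp g k) + w k \<bullet> (ocpR g k *v u k)
      = (y k \<bullet> l k - y (Suc k) \<bullet> l (Suc k)) + ((Mmat g k *v y k) \<bullet> \<mu> k - y k \<bullet> (ocpL g k *v v k))"
    if "k < ?K" for k
  proof -
    have "ocpQ g k *v x k + ocpp g k = l k - ocpL g k *v v k + transpose (Mmat g k) *v \<mu> k
        - transpose (Amat g k) *v l (Suc k)"
      using cs that by (simp add: costates_def Let_def)
    then show ?thesis
      unfolding Ru[OF that] y[OF that]
      by (simp add: inner_add_left inner_add_right inner_diff_right inner_transpose_mult)
  qed
  have "ocpQ g ?K *v x ?K + ocpp g ?K = l ?K - ocpL g ?K *v v ?K + transpose (Mmat g ?K) *v \<mu> ?K"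
    using cs by (simp add: costates_def Let_def)
  then have T: "?T = y ?K \<bullet> l ?K + ((Mmat g ?K *v y ?K) \<bullet> \<mu> ?K - y ?K \<bullet> (ocpL g ?K *v v ?K))"
    by (simp add: inner_add_right inner_diff_right inner_transpose_mult)
  have "?U = (\<Sum>k<?K. y k \<bullet> l k - y (Suc k) \<bullet> l (Suc k))
      + (\<Sum>k<?K. (Mmat g k *v y k) \<bullet> \<mu> k - y k \<bullet> (ocpL g k *v v k))"
    by (simp add: stage sum.distrib)
  also have "(\<Sum>k<?K. y k \<bullet> l k - y (Suc k) \<bullet> l (Suc k)) = - (y ?K \<bullet> l ?K)"
    by (simp add: sum_lessThan_telescope'[of "\<lambda>k. y k \<bullet> l k"] y0)
  \<comment> \<open>The boundary term left by telescoping cancels y_K'l_K from the terminal cost,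
    and the other terminal terms become the summand for k = K.\<close>
  finally have "?T + ?U = (\<Sum>k\<le>?K. (Mmat g k *v y k) \<bullet> \<mu> k - y k \<bullet> (ocpL g k *v v k))"
    by (simp add: T lessThan_Suc_atMost[symmetric])
  then have "?T + ?U + ?V = (\<Sum>k\<le>?K. (Mmat g k *v y k) \<bullet> \<mu> k
      + s k \<bullet> (ocpD g k *v v k + ocpd g k + transpose (ocpL g k) *v x k))"
    by (simp flip: sum.distrib add: algebra_simps)
  also have "\<dots> \<ge> 0"
    using pLCP_variational[OF pL con] by (intro sum_nonneg) simp
  finally show ?thesis .
qed

section \<open>The potential structure\<close>

text \<open>Shows that the definite descriptions are well defined;
  \<open>potential_structure\<close> speaks of distinct players only, so j = i is treated
  apart.\<close>

lemma potential_structure_common: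
  assumes "potential_structure g" and "k \<le> horizon g"
  shows "ocpQ g k = Qmat g k i" and "ocpp g k = pvec g k i" and "ocpL g k = Lmat g k i"
proof -
  have "Qmat g k j = Qmat g k i \<and> pvec g k j = pvec g k i \<and> Lmat g k j = Lmat g k i" for j
    using assms by (cases "j = i") (auto simp: potential_structure_def)
  then show "ocpQ g k = Qmat g k i" and "ocpp g k = pvec g k i" and "ocpL g k = Lmat g k i"
    unfolding ocpQ_def ocpp_def ocpL_def by (auto intro!: the_equality)
qed

text \<open>Entries inside one player's block are symmetric because R^i is; entries across two
  players need the potential structure as well.\<close>

lemma ocpR_sym:
  assumes "game_data g" and "potential_structure g" and "k < horizon g"
  shows "transpose (ocpR g k) = ocpR g k"
proof -
  have "transpose (Rmat g k i) $ a $ b = Rmat g k i $ a $ b" for i a b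
    using assms(1,3) by (simp add: game_data_def)
  then have "Rmat g k (own_u g b) $ b $ a = Rmat g k (own_u g a) $ a $ b" for a b
    using assms(2,3) unfolding potential_structure_def transpose_def
    by (cases "own_u g a = own_u g b") auto
  then show ?thesis
    by (simp add: vec_eq_iff transpose_def ocpR_def)
qed

lemma inner_block_space_own:
  assumes "h \<in> block_space own i" and "\<And>a. own a = i \<Longrightarrow> z $ a = z' $ a"
  shows "h \<bullet> z = h \<bullet> z'"
  unfolding inner_vec_def
proof (rule sum.cong)
  fix a
  show "h $ a \<bullet> z $ a = h $ a \<bullet> z' $ a"
    using assms by (cases "own a = i") (auto simp: block_space_def)
qed simp

text \<open>A deviation of player i meets only the rows owned by i, and these are the rows that OCP1
  takes over in full from player i.\<close>

lemma inner_block_space_ocp: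
  assumes "w \<in> block_space (own_u g) i" and "s \<in> block_space (own_v g) i"
  shows "w \<bullet> (Rmat g k i *v u) = w \<bullet> (ocpR g k *v u)"
    and "s \<bullet> (Dmat g k i *v v) = s \<bullet> (ocpD g k *v v)"
    and "s \<bullet> dvec g k i = s \<bullet> ocpd g k"
  by (rule inner_block_space_own[OF assms(1)] inner_block_space_own[OF assms(2)],
      simp add: matrix_vector_mult_def ocpR_def ocpD_def ocpd_def)+

lemma deviation_self: "deviation own i u u = u"
  by (simp add: fun_eq_iff deviation_def replace_block_def vec_eq_iff)

lemma deviation_diff_block_space: "deviation own i w z k - z k \<in> block_space own i"
  by (simp add: deviation_def replace_block_def block_space_def)

lemma pos_def_on_nonneg:
  assumes "pos_def_on I X"
  shows "0 \<le> (\<Sum>i\<in>I. \<Sum>j\<in>I. z i * X i j * z j)"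
proof (cases "\<exists>i\<in>I. z i \<noteq> 0")
  case True
  then show ?thesis using assms less_imp_le unfolding pos_def_on_def by blast
qed simp

text \<open>Admissibility of the generated controls enters because \<open>is_arg_min\<close>
  requires the candidate itself to be feasible; its state and \<open>v\<close> constraints come from
  \<open>pLCP\<close>.\<close>

theorem theorem4p8:
  fixes g :: "('n::finite, 'm::finite, 's::finite, 'c::finite, 'p::finite) nzdg1"
    and v :: "nat \<Rightarrow> real^'s"
    and \<mu> :: "nat \<Rightarrow> real^'c"
  assumes "game_data g"
    and "potential_structure g"
    and "feasibility g"
    and "\<forall>k<horizon g. invertible (ocpR g k)"
    and "\<forall>k<horizon g. invertible (Gam g k)"
    and "\<forall>k<horizon g. invertible (Tmat g k)"
    and "pos_def_on (bigH_index g) (bigH g)"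
    and "LCP g v \<mu>"
    and "pLCP g 0 (x_init g) (v 0) (\<mu> 0)"
    and "affine_costates g v \<mu>"
    and "\<forall>i. admissible g i (ustar g v \<mu>)"
  shows "open_loop_nash g (ustar g v \<mu>) v"
proof -
  let ?K = "horizon g" and ?u = "ustar g v \<mu>"
  define x where "x = trajectory g ?u"
  have x: "x k = xstar g v \<mu> k" if "k \<le> ?K" for k
    using trajectory_ustar assms(5) that by (simp add: x_def)
  \<comment> \<open>\<open>LCP\<close> covers the times from 1 on; time 0 is the separate problem at
    the initial state.\<close>
  have pL: "pLCP g k (x k) (v k) (\<mu> k)" if "k \<le> ?K" for k
    using LCP_imp_pLCP[OF assms(8), of k] assms(9) that by (cases "k = 0") (simp_all add: x)
  define l where "l k = Hric g k *v xstar g v \<mu> k + beta g v \<mu> k" for k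
  have "costates g (xstar g v \<mu>) v \<mu> l"
    unfolding l_def by (rule costates_affine[OF assms(5)])
  then have cs: "costates g x v \<mu> l"
    by (simp add: costates_def Let_def x)
  have Ru: "ocpR g k *v ?u k = - (transpose (ocpB g k) *v l (Suc k))" if "k < ?K" for k
    using assms(4) that
    by (simp add: ustar_def l_def matrix_vector_mult_uminus
        matrix_vector_mul_assoc[of "ocpR g k" "matrix_inv (ocpR g k)"] matrix_inv_mult del: xstar.simps)
  \<comment> \<open>Here \<open>undefined\<close> stands for an arbitrary player, all of them
    sharing the same Q_k.\<close>
  have Q: "\<forall>k\<le>?K. transpose (ocpQ g k) = ocpQ g k"
    using assms(1,2) by (simp add: potential_structure_common[of g _ undefined] game_data_def)
  have R: "\<forall>k<?K. transpose (ocpR g k) = ocpR g k"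
    using ocpR_sym assms(1,2) by blast
  have le: "cost g i ?u v \<le> cost g i (deviation (own_u g) i u' ?u) (deviation (own_v g) i v' v)"
    if con: "\<forall>k\<le>?K. constraints g k (trajectory g (deviation (own_u g) i u' ?u) k)
      (deviation (own_v g) i v' v k)" for i u' v'
  proof -
    define U where "U = deviation (own_u g) i u' ?u"
    define V where "V = deviation (own_v g) i v' v"
    define y where "y k = trajectory g U k - x k" for k
    define w where "w k = U k - ?u k" for k
    define s where "s k = V k - v k" for k
    have ws: "w k \<in> block_space (own_u g) i" "s k \<in> block_space (own_v g) i" for k
      by (simp_all add: w_def s_def U_def V_def deviation_diff_block_space)
    have y0: "y 0 = 0" by (simp add: y_def x_def)
    have ySuc: "y (Suc k) = Amat g k *v y k + ocpB g k *v w k" for k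
      unfolding y_def w_def x_def by (rule trajectory_diff_Suc)
    define lin where "lin = y ?K \<bullet> (ocpQ g ?K *v x ?K + ocpp g ?K)
      + (\<Sum>k<?K. y k \<bullet> (ocpQ g k *v x k + ocpp g k) + w k \<bullet> (ocpR g k *v ?u k))
      + (\<Sum>k\<le>?K. s k \<bullet> (ocpD g k *v v k + ocpd g k + transpose (ocpL g k) *v x k)
          + y k \<bullet> (ocpL g k *v v k))"
    define quad where "quad = y ?K \<bullet> (ocpQ g ?K *v y ?K)
      + (\<Sum>k<?K. y k \<bullet> (ocpQ g k *v y k) + w k \<bullet> (ocpR g k *v w k))
      + (\<Sum>k\<le>?K. s k \<bullet> (ocpD g k *v s k) + 2 * (y k \<bullet> (ocpL g k *v s k)))"
    have "0 \<le> lin"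
      unfolding lin_def by (rule linear_part_nonneg[OF cs Ru y0 ySuc pL])
        (use con in \<open>simp_all add: y_def s_def U_def V_def\<close>)
    \<comment> \<open>The test vector stacks the control and \<open>v\<close> deviations in the
      index order of \<open>bigH\<close>; non-negativity also covers the zero deviation.\<close>
    moreover have "0 \<le> quad"
      using pos_def_on_nonneg[OF assms(7), of "case_sum (\<lambda>(k, a). w k $ a) (\<lambda>(k, b). s k $ b)"]
      unfolding quad_def bigH_quadratic_form[OF Q R assms(6) y0 ySuc refl] .
    moreover have "cost g i U V = cost g i ?u v + lin + 1/2 * quad"
      unfolding lin_def quad_def
        cost_expansion[OF assms(1), where U = U and u = ?u and V = V and v = v,
          OF y_def[unfolded x_def] w_def s_def refl, folded x_def]
      by (simp add: inner_block_space_ocp[OF ws] inner_add_right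
          potential_structure_common[OF assms(2), where i = i])
    ultimately show ?thesis
      unfolding U_def V_def by linarith
  qed
  have "constraints g k (trajectory g ?u k) (v k)" if "k \<le> ?K" for k
    using pLCP_imp_constraints[OF pL[OF that]] by (simp add: x_def)
  then show ?thesis
    using assms(11) le
    by (simp add: open_loop_nash_def is_arg_min_def deviation_self split_paired_All not_less) blast
qed

end
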